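(* There is a polynomial time $4$-approximation algorithm for OR-scheduling when the precedence DAG is a multitree.
   Context: OR-scheduling: given a set $N$ of jobs, each with processing time $p_j\ge0$ and weight $w_j\ge0$, and a DAG $G=(N,E)$ where $(i,j)\in E$ means $i$ is an OR-predecessor of $j$. Jobs are processed non-preemptively on a single machine, one at a time. A job $j$ with at least one predecessor may start only after at least one of its predecessors has completed; jobs without predecessors may be scheduled at any time. The objective is to minimize $\sum_j w_jC_j$, where $C_j$ is the completion time of job $j$. A multitree is a DAG in which, for every vertex, the subgraph of vertices reachable from it forms an outtree (a DAG in which each vertex has at most one predecessor); equivalently, there is at most one directed path between any two vertices. A $4$-approximation algorithm returns a feasible schedule with objective at most $4$ times the optimum. *)

theory Defs
  imports Complex_Main "HOL-Computational_Algebra.Polynomial" "HOL-Library.Log_Nat"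
begin

section \<open>OR-scheduling on a single machine\<close>

text \<open>
  Processing times, weights and start times are real here; only the input and the output of an
  algorithm (below) are restricted to rationals. \<open>(i, j) \<in> E\<close> means that \<open>i\<close> is an
  OR-predecessor of \<open>j\<close>.
\<close>

definition dag :: "'a set \<Rightarrow> ('a \<times> 'a) set \<Rightarrow> bool" where
  "dag N E \<longleftrightarrow> E \<subseteq> N \<times> N \<and> acyclic E"

definition outtree :: "'a set \<Rightarrow> ('a \<times> 'a) set \<Rightarrow> bool" where
  "outtree N E \<longleftrightarrow> dag N E \<and> (\<forall>j\<in>N. \<forall>i i'. (i, j) \<in> E \<longrightarrow> (i', j) \<in> E \<longrightarrow> i = i')"

definition multitree :: "'a set \<Rightarrow> ('a \<times> 'a) set \<Rightarrow> bool" where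
  "multitree N E \<longleftrightarrow> dag N E \<and>
     (\<forall>v\<in>N. let R = E\<^sup>* `` {v} in outtree R (E \<inter> R \<times> R))"

text \<open>
  A schedule is given by start times \<open>S\<close>; job \<open>j\<close> occupies the machine from \<open>S j\<close> to
  \<open>S j + p j\<close> without interruption. Idle time is allowed. A job with \<open>p j = 0\<close> may not lie
  strictly inside the execution interval of another job.
\<close>

definition completion :: "('a \<Rightarrow> real) \<Rightarrow> ('a \<Rightarrow> real) \<Rightarrow> 'a \<Rightarrow> real" where
  "completion p S j = S j + p j"

definition feasible :: "'a set \<Rightarrow> ('a \<Rightarrow> real) \<Rightarrow> ('a \<times> 'a) set \<Rightarrow> ('a \<Rightarrow> real) \<Rightarrow> bool" where
  "feasible N p E S \<longleftrightarrow>
     (\<forall>j\<in>N. 0 \<le> S j) \<and>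
     (\<forall>i\<in>N. \<forall>j\<in>N. i \<noteq> j \<longrightarrow> completion p S i \<le> S j \<or> completion p S j \<le> S i) \<and>
     (\<forall>j\<in>N. (\<exists>i. (i, j) \<in> E) \<longrightarrow> (\<exists>i. (i, j) \<in> E \<and> completion p S i \<le> S j))"

definition objective :: "'a set \<Rightarrow> ('a \<Rightarrow> real) \<Rightarrow> ('a \<Rightarrow> real) \<Rightarrow> ('a \<Rightarrow> real) \<Rightarrow> real" where
  "objective N p w S = (\<Sum>j\<in>N. w j * completion p S j)"

definition optimum :: "'a set \<Rightarrow> ('a \<Rightarrow> real) \<Rightarrow> ('a \<Rightarrow> real) \<Rightarrow> ('a \<times> 'a) set \<Rightarrow> real" where
  "optimum N p w E = (INF S\<in>{S. feasible N p E S}. objective N p w S)"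


section \<open>Model of computation\<close>

text \<open>
  A random access machine over the natural numbers with the logarithmic cost criterion, programmed
  in a structured while language. The memory consists of arrays of unbounded naturals, indexed by
  names (a program mentions finitely many of them); a scalar variable is cell 0 of an array.
  Every intermediate result of a computation (addresses included) is charged its number of binary
  digits, so that time in this model is polynomially related to Turing machine time, although
  multiplication and division are primitive. \<open>floorlog 2 n\<close> is the number of binary digits
  of \<open>n\<close> (and 0 for \<open>n = 0\<close>).
\<close>

type_synonym vname = string
type_synonym memory = "vname \<Rightarrow> nat \<Rightarrow> nat"

datatype aexp = Num nat | Cell vname aexp
  | Plus aexp aexp | Minus aexp aexp | Times aexp aexp | Div aexp aexp

datatype bexp = Less aexp aexp | Not bexp | And bexp bexp

datatype com = Skip
  | Assign vname aexp aexp  \<comment> \<open>\<open>Assign x a b\<close> stands for \<open>x[a] := b\<close>\<close>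
  | Seq com com
  | If bexp com com
  | While bexp com

fun aval :: "aexp \<Rightarrow> memory \<Rightarrow> nat" where
  "aval (Num n) s = n"
| "aval (Cell x a) s = s x (aval a s)"
| "aval (Plus a b) s = aval a s + aval b s"
| "aval (Minus a b) s = aval a s - aval b s"
| "aval (Times a b) s = aval a s * aval b s"
| "aval (Div a b) s = aval a s div aval b s"

fun bval :: "bexp \<Rightarrow> memory \<Rightarrow> bool" where
  "bval (Less a b) s \<longleftrightarrow> aval a s < aval b s"
| "bval (Not b) s \<longleftrightarrow> \<not> bval b s"
| "bval (And b c) s \<longleftrightarrow> bval b s \<and> bval c s"

definition cost :: "nat \<Rightarrow> nat" where
  "cost n = 1 + floorlog 2 n"

fun acost :: "aexp \<Rightarrow> memory \<Rightarrow> nat" where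
  "acost (Num n) s = cost n"
| "acost (Cell x a) s = acost a s + cost (aval (Cell x a) s)"
| "acost (Plus a b) s = acost a s + acost b s + cost (aval (Plus a b) s)"
| "acost (Minus a b) s = acost a s + acost b s + cost (aval (Minus a b) s)"
| "acost (Times a b) s = acost a s + acost b s + cost (aval (Times a b) s)"
| "acost (Div a b) s = acost a s + acost b s + cost (aval (Div a b) s)"

fun bcost :: "bexp \<Rightarrow> memory \<Rightarrow> nat" where
  "bcost (Less a b) s = 1 + acost a s + acost b s"
| "bcost (Not b) s = 1 + bcost b s"
| "bcost (And b c) s = 1 + bcost b s + bcost c s"

text \<open>\<open>exec c s t s'\<close>: started in memory \<open>s\<close>, program \<open>c\<close> halts in \<open>s'\<close> after time \<open>t\<close>.\<close>

inductive exec :: "com \<Rightarrow> memory \<Rightarrow> nat \<Rightarrow> memory \<Rightarrow> bool" where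
  Skip: "exec Skip s 1 s"
| Assign: "exec (Assign x a b) s (1 + acost a s + acost b s)
     (s(x := (s x)(aval a s := aval b s)))"
| Seq: "exec c s t s' \<Longrightarrow> exec d s' u s'' \<Longrightarrow> exec (Seq c d) s (1 + t + u) s''"
| IfTrue: "bval b s \<Longrightarrow> exec c s t s' \<Longrightarrow> exec (If b c d) s (1 + bcost b s + t) s'"
| IfFalse: "\<not> bval b s \<Longrightarrow> exec d s t s' \<Longrightarrow> exec (If b c d) s (1 + bcost b s + t) s'"
| WhileFalse: "\<not> bval b s \<Longrightarrow> exec (While b c) s (1 + bcost b s) s"
| WhileTrue: "bval b s \<Longrightarrow> exec c s t s' \<Longrightarrow> exec (While b c) s' u s'' \<Longrightarrow>
     exec (While b c) s (1 + bcost b s + t + u) s''"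

inductive_cases SkipE: "exec Skip s t s'"
inductive_cases AssignE: "exec (Assign x a b) s t s'"
inductive_cases SeqE: "exec (Seq c d) s t s'"
inductive_cases IfE: "exec (If b c d) s t s'"
inductive_cases WhileE: "exec (While b c) s t s'"

lemma exec_deterministic:
  "exec c s t s' \<Longrightarrow> exec c s u s'' \<Longrightarrow> t = u \<and> s' = s''"
proof (induction arbitrary: u s'' rule: exec.induct)
  case (Skip s)
  then show ?case by (rule SkipE) simp
next
  case (Assign x a b s)
  then show ?case by (rule AssignE) simp
next
  case (Seq c s t s' d v r)
  from Seq.prems show ?case
    by (rule SeqE) (auto dest!: Seq.IH)
next
  case (IfTrue b s c t s' d)
  from IfTrue.prems show ?case
    by (rule IfE) (use IfTrue.hyps in \<open>auto dest!: IfTrue.IH\<close>)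
next
  case (IfFalse b s d t s' c)
  from IfFalse.prems show ?case
    by (rule IfE) (use IfFalse.hyps in \<open>auto dest!: IfFalse.IH\<close>)
next
  case (WhileFalse b s c)
  from WhileFalse.prems show ?case
    by (rule WhileE) (use WhileFalse.hyps in auto)
next
  case (WhileTrue b s c t s' v r)
  from WhileTrue.prems show ?case
    by (rule WhileE) (use WhileTrue.hyps in \<open>auto dest!: WhileTrue.IH\<close>)
qed

text \<open>
  A list is stored in an array with its length in cell 0 and its elements from cell 1 on. The input
  is found in the array \<open>in\<close>, all other cells being 0, and the output is left in the array
  \<open>out\<close>.
\<close>

definition input_memory :: "nat list \<Rightarrow> memory" where
  "input_memory xs =
     (\<lambda>x i. if x = ''in'' \<and> i \<le> length xs then (length xs # xs) ! i else 0)"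

definition output_list :: "memory \<Rightarrow> nat list" where
  "output_list s = map (s ''out'') [1..<Suc (s ''out'' 0)]"

definition input_size :: "nat list \<Rightarrow> nat" where
  "input_size xs = (\<Sum>x\<leftarrow>xs. cost x)"


section \<open>Approximation algorithms for OR-scheduling\<close>

text \<open>The jobs of an instance are \<open>0, \<dots>, njobs I - 1\<close>.\<close>

record or_inst =
  njobs :: nat
  ptime :: "nat \<Rightarrow> rat"
  weight :: "nat \<Rightarrow> rat"
  prec :: "(nat \<times> nat) set"

definition jobs :: "or_inst \<Rightarrow> nat set" where
  "jobs I = {..<njobs I}"

definition valid_inst :: "or_inst \<Rightarrow> bool" where
  "valid_inst I \<longleftrightarrow> dag (jobs I) (prec I) \<and> (\<forall>j\<in>jobs I. 0 \<le> ptime I j \<and> 0 \<le> weight I j)"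

definition ptime_real :: "or_inst \<Rightarrow> nat \<Rightarrow> real" where
  "ptime_real I j = of_rat (ptime I j)"

definition weight_real :: "or_inst \<Rightarrow> nat \<Rightarrow> real" where
  "weight_real I j = of_rat (weight I j)"

text \<open>
  A nonnegative rational is encoded by numerator and denominator in lowest terms, the DAG by its
  adjacency matrix (row by row).
\<close>

definition encode_rat :: "rat \<Rightarrow> nat list" where
  "encode_rat q = (let (a, b) = quotient_of q in [nat a, nat b])"

definition encode_inst :: "or_inst \<Rightarrow> nat list" where
  "encode_inst I = [njobs I] @
     concat (map (\<lambda>j. encode_rat (ptime I j) @ encode_rat (weight I j)) [0..<njobs I]) @
     concat (map (\<lambda>i. map (\<lambda>j. if (i, j) \<in> prec I then 1 else 0) [0..<njobs I]) [0..<njobs I])"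

text \<open>
  A schedule for \<open>n\<close> jobs is output as the list of the numerators and (nonzero) denominators of
  the start times, not necessarily in lowest terms.
\<close>

definition encodes_schedule :: "nat \<Rightarrow> nat list \<Rightarrow> (nat \<Rightarrow> real) \<Rightarrow> bool" where
  "encodes_schedule n ys S \<longleftrightarrow> length ys = 2 * n \<and>
     (\<forall>j<n. ys ! (2 * j + 1) \<noteq> 0 \<and> S j = real (ys ! (2 * j)) / real (ys ! (2 * j + 1)))"

definition polytime_approximation :: "real \<Rightarrow> or_inst set \<Rightarrow> com \<Rightarrow> bool" where
  "polytime_approximation \<alpha> \<I> c \<longleftrightarrow>
     (\<exists>q :: nat poly. \<forall>I\<in>\<I>. \<exists>t s S.
        exec c (input_memory (encode_inst I)) t s \<and>
        t \<le> poly q (input_size (encode_inst I)) \<and>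
        encodes_schedule (njobs I) (output_list s) S \<and>
        feasible (jobs I) (ptime_real I) (prec I) S \<and>
        objective (jobs I) (ptime_real I) (weight_real I) S
          \<le> \<alpha> * optimum (jobs I) (ptime_real I) (weight_real I) (prec I))"

end

theory Submission imports Defs begin

text \<open>
  The algorithm repeatedly schedules a set of remaining jobs of maximum density (weight divided by
  processing time) among those that can be started now, as in the greedy algorithm for min-sum set
  cover. In a multitree a densest set is found among the subtrees rooted at available jobs, and the
  densest subtree of a given root arises from its full tree by repeatedly cutting off a subtree
  whose density is below that of the whole and which is minimal with this property.

  If the block \<open>U\<close> has density \<open>\<rho>\<close> when the jobs \<open>R\<close> remain, then any schedule completes at most
  half the weight of \<open>R\<close> before time \<open>\<phi> / 2\<close> with \<open>\<phi> = w(R) / \<rho>\<close>, since the jobs of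
  \<open>R\<close> completed by time \<open>\<tau>\<close> form a startable set and so have weight at most \<open>\<rho> \<tau>\<close>. Scheduling
  \<open>U\<close> costs at most \<open>p(U) w(R) = w(U) \<phi>\<close>; replacing \<open>\<phi>\<close> by its running maximum
  \<open>\<Phi>\<close> and summing by parts, each increase of \<open>\<Phi>\<close> is paid for by the weight that the optimum
  has not completed at time \<open>\<Phi> / 2\<close>, with a factor of two lost in time and another in weight.

  For the running time it suffices that all loops run at most \<open>n\<close> times and that all memory
  cells stay below a fixed power of two, whose exponent is linear in the input size.
\<close>

section \<open>A weakest-precondition calculus with time bounds\<close>

text \<open>A startable set may combine trees of several roots, and such trees overlap, so it is not
  obvious that the maximum density is attained by a single tree. But a startable set can be
  partitioned by peeling off, root by root, what is reachable inside it, and some part of a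
  partition is at least as dense as the whole. This leaves one root at a time, and below one root
  the ancestors of a job form a chain.

  The cut has to be minimal: then the subtrees properly inside the sparse one are at least as dense
  as the whole tree, so every rooted part of the piece cut off is at most as dense as the whole, and
  nothing that is removed is ever wanted again.

  The maximum of \<phi> is taken because w(R) falls from block to block: for two independent jobs of
  equal positive density the second value is the smaller one. The constant 4 is that of the
  histogram argument for min-sum set cover.

  Densities are compared by products of naturals, as the machine does it. A processing time of zero
  is therefore the recurring special case: comparison through a fraction 0/0 is not
  transitive.\<close>

fun degr :: "aexp \<Rightarrow> nat" where
  "degr (Num n) = Suc n"
| "degr (Cell x a) = 1"
| "degr (Plus a b) = degr a + degr b"
| "degr (Minus a b) = degr a"
| "degr (Times a b) = degr a + degr b"
| "degr (Div a b) = degr a"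

text \<open>Both measures refer to memories with cells below \<open>2 ^ \<kappa>\<close>:
  \<open>degr\<close> bounds the length of a value in units of \<open>\<kappa>\<close> bits,
  \<open>atime\<close> the cost of an evaluation in units of \<open>1 + \<kappa>\<close>. A numeral
  counts \<open>Suc n\<close> because \<open>n < 2 ^ Suc n\<close>; this is crude, but the numerals
  of a program are fixed.\<close>

fun atime :: "aexp \<Rightarrow> nat" where
  "atime (Num n) = Suc n"
| "atime (Cell x a) = atime a + 1"
| "atime (Plus a b) = atime a + atime b + degr (Plus a b)"
| "atime (Minus a b) = atime a + atime b + degr (Minus a b)"
| "atime (Times a b) = atime a + atime b + degr (Times a b)"
| "atime (Div a b) = atime a + atime b + degr (Div a b)"

fun btime :: "bexp \<Rightarrow> nat" where
  "btime (Less a b) = 1 + atime a + atime b"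
| "btime (Not b) = 1 + btime b"
| "btime (And b c) = 1 + btime b + btime c"

text \<open>The branches of a conditional are added rather than maximised, which keeps the bound a
  polynomial in \<open>N\<close>, the limit on the iterations of every loop. The factor
  \<open>N + 1\<close> includes the final test.\<close>

fun ctime :: "nat \<Rightarrow> com \<Rightarrow> nat" where
  "ctime N Skip = 1"
| "ctime N (Assign x a b) = 1 + atime a + atime b"
| "ctime N (Seq c d) = 1 + ctime N c + ctime N d"
| "ctime N (If b c d) = 1 + btime b + ctime N c + ctime N d"
| "ctime N (While b c) = (N + 1) * (1 + btime b + ctime N c)"

fun writes :: "com \<Rightarrow> vname set" where
  "writes Skip = {}"
| "writes (Assign x a b) = {x}"
| "writes (Seq c d) = writes c \<union> writes d"
| "writes (If b c d) = writes c \<union> writes d"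
| "writes (While b c) = writes c"

lemma ctime_poly: "\<exists>q. \<forall>N. ctime N c = poly q N"
proof (induction c)
  case Skip
  then show ?case by (intro exI[of _ 1]) simp
next
  case (Assign x a b)
  then show ?case by (intro exI[of _ "[:1 + atime a + atime b:]"]) simp
next
  case (Seq c d)
  then obtain q r where "\<forall>N. ctime N c = poly q N" "\<forall>N. ctime N d = poly r N" by auto
  then show ?case by (intro exI[of _ "1 + q + r"]) simp
next
  case (If b c d)
  then obtain q r where "\<forall>N. ctime N c = poly q N" "\<forall>N. ctime N d = poly r N" by auto
  then show ?case by (intro exI[of _ "[:1 + btime b:] + q + r"]) simp
next
  case (While b c)
  then obtain q where "\<forall>N. ctime N c = poly q N" by auto
  then show ?case by (intro exI[of _ "[:1, 1:] * ([:1 + btime b:] + q)"]) simp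
qed

lemma exec_frame: "exec c s t s' \<Longrightarrow> x \<notin> writes c \<Longrightarrow> s' x = s x"
  by (induction rule: exec.induct) auto

lemma cost_less_power: "v < 2 ^ (k * d) \<Longrightarrow> 0 < d \<Longrightarrow> cost v \<le> d * (1 + k)"
proof -
  assume v: "v < 2 ^ (k * d)" and d: "0 < d"
  have "floorlog 2 v \<le> k * d" using v floorlog_leI by fastforce
  then have "cost v \<le> 1 + k * d" by (simp add: cost_def)
  also have "\<dots> \<le> d * (1 + k)" using d by (simp add: algebra_simps)
  finally show ?thesis .
qed

lemma degr_pos: "0 < degr a"
  by (induction a) auto

section \<open>Time bounds for memories with cells of bounded length\<close>

locale bounded_machine =
  fixes \<kappa> N :: nat
  assumes kappa: "1 \<le> \<kappa>"
begin

definition bounded :: "memory \<Rightarrow> bool" where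
  "bounded s \<longleftrightarrow> (\<forall>x i. s x i < 2 ^ \<kappa>)"

lemma add_less_mult:
  fixes a b x y :: nat
  assumes "a < x" "b < y" "2 \<le> x" "2 \<le> y"
  shows "a + b < x * y"
proof -
  obtain x' y' where "x = 2 + x'" "y = 2 + y'" using assms by (metis le_Suc_ex)
  then show ?thesis using assms by (simp add: algebra_simps)
qed

lemma two_le_power: "0 < d \<Longrightarrow> (2::nat) \<le> 2 ^ (\<kappa> * d)"
  using self_le_power[of "2::nat" "\<kappa> * d"] kappa by simp

lemma aval_bound: "bounded s \<Longrightarrow> aval a s < 2 ^ (\<kappa> * degr a)"
proof (induction a)
  case (Num n)
  have "n < 2 ^ Suc n" using less_exp[of n] by (simp add: trans_less_add1 del: less_exp)
  also have "\<dots> \<le> 2 ^ (\<kappa> * Suc n)" using mult_le_mono1[OF kappa, of "Suc n"] by (intro power_increasing) auto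
  finally show ?case by simp
next
  case (Cell x a)
  then show ?case by (simp add: bounded_def)
next
  case (Plus a b)
  then show ?case using add_less_mult[OF _ _ two_le_power two_le_power, of "aval a s" "degr a" "aval b s" "degr b"]
    by (simp add: degr_pos algebra_simps power_add)
next
  case (Times a b)
  then show ?case
    by (simp add: algebra_simps power_add mult_strict_mono')
next
  case (Minus a b)
  then show ?case by (simp add: less_imp_diff_less)
next
  case (Div a b)
  have "aval a s div aval b s \<le> aval a s" by simp
  then show ?case using Div by (metis aval.simps(6) degr.simps(6) le_less_trans)
qed

lemma cost_aval: "bounded s \<Longrightarrow> cost (aval a s) \<le> degr a * (1 + \<kappa>)"
  using cost_less_power[OF aval_bound degr_pos] .

lemma acost_bound: "bounded s \<Longrightarrow> acost a s \<le> atime a * (1 + \<kappa>)"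
proof (induction a)
  case (Num n)
  then show ?case using cost_aval[OF Num, of "Num n"] by simp
next
  case (Cell x a)
  then show ?case using cost_aval[OF Cell(2), of "Cell x a"] by (simp add: algebra_simps)
next
  case (Plus a b)
  then show ?case using cost_aval[OF Plus(3), of "Plus a b"] by (simp add: algebra_simps)
next
  case (Times a b)
  then show ?case using cost_aval[OF Times(3), of "Times a b"] by (simp add: algebra_simps)
next
  case (Minus a b)
  then show ?case using cost_aval[OF Minus(3), of "Minus a b"] by (simp add: algebra_simps)
next
  case (Div a b)
  then show ?case using cost_aval[OF Div(3), of "Div a b"] by (simp add: algebra_simps)
qed

lemma bcost_bound: "bounded s \<Longrightarrow> bcost b s \<le> btime b * (1 + \<kappa>)"
proof (induction b)
  case (Less a b)
  then show ?case using acost_bound[OF Less, of a] acost_bound[OF Less, of b] by (simp add: algebra_simps)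
qed (auto simp: algebra_simps)

text \<open>Total correctness, the time bound and preservation of \<open>bounded\<close> in one
  predicate. Boundedness of the initial memory is a premise inside it, so the rules pass it on and
  no specification has to repeat it.\<close>

definition wp :: "com \<Rightarrow> (memory \<Rightarrow> bool) \<Rightarrow> memory \<Rightarrow> bool" where
  "wp c Q s \<longleftrightarrow> (bounded s \<longrightarrow>
     (\<exists>t s'. exec c s t s' \<and> t \<le> ctime N c * (1 + \<kappa>) \<and> bounded s' \<and> Q s'))"

text \<open>Specifications mention only what a program computes; that everything else persists is
  recovered here from \<open>writes\<close>.\<close>

lemma wp_conseq:
  assumes "wp c Q s" "\<And>s'. \<forall>x. x \<notin> writes c \<longrightarrow> s' x = s x \<Longrightarrow> bounded s' \<Longrightarrow> Q s' \<Longrightarrow> Q' s'"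
  shows "wp c Q' s"
  using assms exec_frame unfolding wp_def by metis

lemma wp_Skip: "Q s \<Longrightarrow> wp Skip Q s"
  unfolding wp_def by (metis add_leD1 ctime.simps(1) exec.Skip mult_1 nle_le)

text \<open>Only the stored value has to stay below \<open>2 ^ \<kappa>\<close>. Products that are
  merely compared, or occur inside an expression, may be longer and are paid for through
  \<open>degr\<close>.\<close>

lemma wp_Assign:
  assumes "bounded s \<Longrightarrow> aval b s < 2 ^ \<kappa>" "Q (s(x := (s x)(aval a s := aval b s)))"
  shows "wp (Assign x a b) Q s"
  unfolding wp_def
proof (intro impI)
  assume s: "bounded s"
  have "1 + acost a s + acost b s \<le> ctime N (Assign x a b) * (1 + \<kappa>)"
    using acost_bound[OF s, of a] acost_bound[OF s, of b] by (simp add: algebra_simps)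
  moreover have "bounded (s(x := (s x)(aval a s := aval b s)))"
    using s assms(1) by (auto simp: bounded_def)
  ultimately show "\<exists>t s'. exec (Assign x a b) s t s' \<and> t \<le> ctime N (Assign x a b) * (1 + \<kappa>) \<and> bounded s' \<and> Q s'"
    using assms(2) exec.Assign by blast
qed

lemma wp_Seq:
  assumes "wp c R s"
    "\<And>s'. \<forall>x. x \<notin> writes c \<longrightarrow> s' x = s x \<Longrightarrow> bounded s' \<Longrightarrow> R s' \<Longrightarrow> wp d Q s'"
  shows "wp (Seq c d) Q s"
  unfolding wp_def
proof (intro impI)
  assume "bounded s"
  then obtain t s' where 1: "exec c s t s'" "t \<le> ctime N c * (1 + \<kappa>)" "bounded s'" "R s'"
    using assms(1) by (auto simp: wp_def)
  then have "wp d Q s'" using assms(2) exec_frame by blast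
  then obtain u s'' where 2: "exec d s' u s''" "u \<le> ctime N d * (1 + \<kappa>)" "bounded s''" "Q s''"
    using 1 by (auto simp: wp_def)
  have "1 + t + u \<le> ctime N (Seq c d) * (1 + \<kappa>)" using 1(2) 2(2) by (simp add: algebra_simps)
  then show "\<exists>t s'. exec (Seq c d) s t s' \<and> t \<le> ctime N (Seq c d) * (1 + \<kappa>) \<and> bounded s' \<and> Q s'"
    using exec.Seq[OF 1(1) 2(1)] 2(3,4) by blast
qed

lemma wp_If:
  assumes "bval b s \<Longrightarrow> wp c Q s" "\<not> bval b s \<Longrightarrow> wp d Q s"
  shows "wp (If b c d) Q s"
  unfolding wp_def
proof (intro impI)
  assume s: "bounded s"
  show "\<exists>t s'. exec (If b c d) s t s' \<and> t \<le> ctime N (If b c d) * (1 + \<kappa>) \<and> bounded s' \<and> Q s'"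
  proof (cases "bval b s")
    case True
    then obtain t s' where 1: "exec c s t s'" "t \<le> ctime N c * (1 + \<kappa>)" "bounded s'" "Q s'"
      using assms(1) s by (auto simp: wp_def)
    have "1 + bcost b s + t \<le> ctime N (If b c d) * (1 + \<kappa>)"
      using 1(2) bcost_bound[OF s, of b] by (simp add: algebra_simps)
    then show ?thesis using exec.IfTrue[OF True 1(1)] 1(3,4) by blast
  next
    case False
    then obtain t s' where 1: "exec d s t s'" "t \<le> ctime N d * (1 + \<kappa>)" "bounded s'" "Q s'"
      using assms(2) s by (auto simp: wp_def)
    have "1 + bcost b s + t \<le> ctime N (If b c d) * (1 + \<kappa>)"
      using 1(2) bcost_bound[OF s, of b] by (simp add: algebra_simps)
    then show ?thesis using exec.IfFalse[OF False 1(1)] 1(3,4) by blast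
  qed
qed

text \<open>The index of the invariant counts completed iterations and decides the test, so the body
  runs exactly \<open>n - k\<close> more times. This gives termination and the time bound without a
  separate variant.\<close>

lemma exec_While:
  assumes step: "\<And>k s. k < n \<Longrightarrow> bounded s \<Longrightarrow> I k s \<Longrightarrow> bval b s \<and> wp c (I (Suc k)) s"
    and stop: "\<And>s. bounded s \<Longrightarrow> I n s \<Longrightarrow> \<not> bval b s"
    and "k \<le> n" "bounded s" "I k s"
  shows "\<exists>t s'. exec (While b c) s t s' \<and>
    t \<le> (n - k + 1) * ((1 + btime b + ctime N c) * (1 + \<kappa>)) \<and> bounded s' \<and> I n s'"
  using assms(3-)
proof (induction "n - k" arbitrary: k s)
  case 0
  then have [simp]: "k = n" by simp
  have "1 + bcost b s \<le> (n - k + 1) * ((1 + btime b + ctime N c) * (1 + \<kappa>))"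
    using bcost_bound[OF 0(3), of b] by (simp add: algebra_simps)
  then show ?case using exec.WhileFalse[OF stop, of s c] 0 by auto
next
  case (Suc m)
  then have k: "k < n" by simp
  obtain t s' where 1: "bval b s" "exec c s t s'" "t \<le> ctime N c * (1 + \<kappa>)" "bounded s'" "I (Suc k) s'"
    using step[OF k Suc(4,5)] Suc(4) by (auto simp: wp_def)
  obtain u s'' where 2: "exec (While b c) s' u s''" "bounded s''" "I n s''"
    "u \<le> (n - Suc k + 1) * ((1 + btime b + ctime N c) * (1 + \<kappa>))"
    using Suc(1)[OF _ _ 1(4,5)] Suc(2) k by (metis Suc_diff_Suc Suc_inject Suc_leI)
  define X where "X = (1 + btime b + ctime N c) * (1 + \<kappa>)"
  have "1 + bcost b s + t \<le> X"
    using 1(3) bcost_bound[OF Suc(4), of b] by (simp add: X_def algebra_simps)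
  moreover have "u \<le> (n - Suc k + 1) * X" using 2(4) by (simp only: X_def)
  moreover have "(n - k + 1) * X = X + (n - Suc k + 1) * X"
    using k by (simp flip: mult_Suc add: Suc_diff_Suc)
  ultimately have "1 + bcost b s + t + u \<le> (n - k + 1) * X" by linarith
  then show ?case using exec.WhileTrue[OF 1(1,2) 2(1)] 2(2,3) unfolding X_def by blast
qed

end

abbreviation Var :: "vname \<Rightarrow> aexp" where
  "Var x \<equiv> Cell x (Num 0)"

abbreviation Set :: "vname \<Rightarrow> aexp \<Rightarrow> com" where
  "Set x \<equiv> Assign x (Num 0)"

definition For :: "vname \<Rightarrow> com \<Rightarrow> com" where
  "For i c = Seq (Set i (Num 0))
     (While (Less (Var i) (Var ''n'')) (Seq c (Set i (Plus (Var i) (Num 1)))))"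

lemma writes_For [simp]: "writes (For i c) = insert i (writes c)"
  by (auto simp: For_def)

context bounded_machine
begin

text \<open>By \<open>indep\<close> the invariant does not see the counter array and so survives
  initialisation and increment; the value of the counter is available as the index \<open>k\<close>
  instead.\<close>

lemma wp_For:
  assumes n: "s ''n'' 0 = n" "n \<le> N"
    and i: "i \<noteq> ''n''" "i \<notin> writes c" "''n'' \<notin> writes c"
    and indep: "\<And>k s' f. I k s' \<Longrightarrow> I k (s'(i := f))"
    and init: "I 0 s"
    and step: "\<And>k s'. k < n \<Longrightarrow> s' i 0 = k \<Longrightarrow> \<forall>x. x \<noteq> i \<and> x \<notin> writes c \<longrightarrow> s' x = s x \<Longrightarrow>
      bounded s' \<Longrightarrow> I k s' \<Longrightarrow> wp c (I (Suc k)) s'"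
    and fin: "\<And>s'. \<forall>x. x \<noteq> i \<and> x \<notin> writes c \<longrightarrow> s' x = s x \<Longrightarrow> I n s' \<Longrightarrow> Q s'"
  shows "wp (For i c) Q s"
  unfolding For_def
proof (rule wp_Seq[where R = "\<lambda>s'. I 0 s' \<and> s' i 0 = 0"], goal_cases)
  case 1
  show ?case by (rule wp_Assign) (auto intro: init indep)
next
  case (2 s1)
  define J where "J k s' \<longleftrightarrow> I k s' \<and> s' i 0 = k \<and> (\<forall>x. x \<noteq> i \<and> x \<notin> writes c \<longrightarrow> s' x = s x)" for k s'
  have "bounded s1 \<Longrightarrow> \<exists>t s'. exec (While (Less (Var i) (Var ''n'')) (Seq c (Set i (Plus (Var i) (Num 1))))) s1 t s' \<and>
    t \<le> (n - 0 + 1) * ((1 + btime (Less (Var i) (Var ''n'')) + ctime N (Seq c (Set i (Plus (Var i) (Num 1))))) * (1 + \<kappa>))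
     \<and> bounded s' \<and> J n s'"
  proof (rule exec_While, goal_cases)
    case (1 k s')
    then have n': "s' ''n'' 0 = n" using i n by (auto simp: J_def)
    have "n < 2 ^ \<kappa>" using 1 n' unfolding bounded_def by metis
    then have "wp (Seq c (Set i (Plus (Var i) (Num 1)))) (J (Suc k)) s'"
      using 1 i n
      by (intro wp_Seq[OF step] wp_Assign) (auto simp: J_def intro: indep)
    moreover have "bval (Less (Var i) (Var ''n'')) s'" using 1 n' by (simp add: J_def)
    ultimately show ?case by blast
  next
    case (2 s')
    then show ?case using i n by (auto simp: J_def)
  next
    case 4
    then show ?case .
  next
    case 5
    then show ?case using 2 i by (auto simp: J_def)
  qed auto
  then obtain t s' where t: "bounded s1 \<Longrightarrow> exec (While (Less (Var i) (Var ''n'')) (Seq c (Set i (Plus (Var i) (Num 1))))) s1 t s' \<and>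
    t \<le> (n + 1) * ((1 + btime (Less (Var i) (Var ''n'')) + ctime N (Seq c (Set i (Plus (Var i) (Num 1))))) * (1 + \<kappa>))
     \<and> bounded s' \<and> J n s'" by auto
  have "t \<le> ctime N (While (Less (Var i) (Var ''n'')) (Seq c (Set i (Plus (Var i) (Num 1))))) * (1 + \<kappa>)" if "bounded s1"
  proof -
    have "(n + 1) * ((1 + btime (Less (Var i) (Var ''n'')) + ctime N (Seq c (Set i (Plus (Var i) (Num 1))))) * (1 + \<kappa>))
      \<le> (N + 1) * ((1 + btime (Less (Var i) (Var ''n'')) + ctime N (Seq c (Set i (Plus (Var i) (Num 1))))) * (1 + \<kappa>))"
      using n(2) by (intro mult_right_mono) auto
    then show ?thesis using t[OF that] unfolding ctime.simps mult.assoc by (meson le_trans)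
  qed
  then show ?case using t fin unfolding wp_def by (auto simp: J_def)
qed

end

section \<open>Densest rooted subtrees of a multitree\<close>

lemma multitree_unique_parent:
  assumes "multitree N E" "(r, i) \<in> E\<^sup>*" "(r, i') \<in> E\<^sup>*" "(i, j) \<in> E" "(i', j) \<in> E"
  shows "i = i'"
proof -
  define R where "R = E\<^sup>* `` {r}"
  have E: "E \<subseteq> N \<times> N" using assms(1) by (simp add: multitree_def dag_def)
  have "r \<in> N" using assms(2,4) E by (metis SigmaD1 converse_rtranclE subsetD)
  then have "outtree R (E \<inter> R \<times> R)"
    using assms(1) by (auto simp: multitree_def Let_def R_def)
  moreover have "j \<in> R" "i \<in> R" "i' \<in> R" using assms by (auto simp: R_def intro: rtrancl_into_rtrancl)
  ultimately show ?thesis using assms(4,5) unfolding outtree_def by blast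
qed

locale weighted_multitree =
  fixes N :: "'a set" and E :: "('a \<times> 'a) set" and p w :: "'a \<Rightarrow> nat"
  assumes fin: "finite N" and mt: "multitree N E"
begin

definition desc :: "'a \<Rightarrow> 'a set" where
  "desc v = E\<^sup>* `` {v}"

lemma E_sub: "E \<subseteq> N \<times> N" and E_acyclic: "acyclic E"
  using mt by (auto simp: multitree_def dag_def)

lemma desc_refl [simp]: "v \<in> desc v"
  by (simp add: desc_def)

lemma desc_trans: "v \<in> desc u \<Longrightarrow> x \<in> desc v \<Longrightarrow> x \<in> desc u"
  by (simp add: desc_def)

lemma desc_antisym: "v \<in> desc u \<Longrightarrow> u \<in> desc v \<Longrightarrow> u = v"
  using E_acyclic acyclic_impl_antisym_rtrancl by (auto simp: desc_def antisym_def)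

lemma desc_edge: "x \<in> desc u \<Longrightarrow> (x, y) \<in> E \<Longrightarrow> y \<in> desc u"
  by (auto simp: desc_def intro: rtrancl_into_rtrancl)

text \<open>The last edge of a path from \<open>x\<close> to \<open>u\<close> starts at the only
  predecessor of \<open>u\<close> below \<open>r\<close>, which is \<open>i\<close>.\<close>

lemma desc_parent:
  assumes "x \<in> desc r" "u \<in> desc x" "i \<in> desc r" "(i, u) \<in> E" "x \<noteq> u"
  shows "i \<in> desc x"
proof -
  obtain i' where "(x, i') \<in> E\<^sup>*" "(i', u) \<in> E"
    using assms(2,5) by (auto simp: desc_def elim: rtranclE)
  moreover from this have "i' = i"
    using assms by (intro multitree_unique_parent[OF mt, of r]) (auto simp: desc_def)
  ultimately show ?thesis by (simp add: desc_def)
qed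

text \<open>Induction from \<open>u\<close> back to \<open>x\<close>: if a vertex of the path lies
  strictly below \<open>v\<close>, its predecessor on the path lies below \<open>v\<close> or equals
  it; once \<open>v\<close> is met, it is below all earlier vertices.\<close>

lemma desc_chain:
  assumes "x \<in> desc r" "v \<in> desc r" "u \<in> desc x" "u \<in> desc v"
  shows "v \<in> desc x \<or> x \<in> desc v"
proof -
  have "(x, u) \<in> E\<^sup>*" using assms by (simp add: desc_def)
  then show ?thesis using assms(1,4)
  proof (induction rule: converse_rtrancl_induct)
    case base
    then show ?case by simp
  next
    case (step x x')
    then have "x' \<in> desc r" "x' \<in> desc x" using desc_edge desc_refl by blast+
    with step have "v \<in> desc x' \<or> x' \<in> desc v" by simp
    then show ?case
    proof
      assume "v \<in> desc x'"
      then show ?thesis using \<open>x' \<in> desc x\<close> desc_trans by blast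
    next
      assume x': "x' \<in> desc v"
      show ?thesis
      proof (cases "v = x'")
        case True
        then show ?thesis using \<open>x' \<in> desc x\<close> by simp
      next
        case False
        then show ?thesis using desc_parent[OF assms(2) x' step(4) step(1)] by simp
      qed
    qed
  qed
qed

text \<open>
  Rooted subtrees of the remaining jobs \<open>R\<close>: paths may pass through completed jobs.
\<close>

definition closed :: "'a set \<Rightarrow> 'a \<Rightarrow> 'a set \<Rightarrow> bool" where
  "closed R r U \<longleftrightarrow> U \<subseteq> R \<inter> desc r \<and> (\<forall>u\<in>U. \<forall>v\<in>R. v \<in> desc r \<longrightarrow> u \<in> desc v \<longrightarrow> v \<in> U)"

lemma closed_Un: "closed R r U \<Longrightarrow> closed R r V \<Longrightarrow> closed R r (U \<union> V)"
  unfolding closed_def by blast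

lemma closed_Int: "closed R r U \<Longrightarrow> closed R r V \<Longrightarrow> closed R r (U \<inter> V)"
  unfolding closed_def by blast

lemma closed_full: "closed R r (R \<inter> desc r)"
  unfolding closed_def by blast

lemma closed_remove: "closed R r T \<Longrightarrow> closed R r (T - desc v)"
  unfolding closed_def using desc_trans by blast

lemma sum_split:
  fixes f :: "'a \<Rightarrow> nat"
  assumes "finite T"
  shows "sum f T = sum f (T - S) + sum f (T \<inter> S)"
  using sum.Int_Diff[OF assms, of f S] by simp

lemma wf_E: "wf E"
  using E_sub fin E_acyclic by (simp add: wf_iff_acyclic_if_finite finite_subset)

text \<open>\<open>X - Q\<close> is a disjoint union of full subtrees of \<open>X\<close>, one for
  each of its topmost jobs, so the lower bound \<open>d / c\<close> on the density of the subtrees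
  passes to the union. The induction moves one such subtree into \<open>Q\<close>.\<close>

lemma stable_diff:
  assumes "R \<subseteq> N" "closed R r X" "closed R r Q" "Q \<subseteq> X"
    and "\<And>u. u \<in> X - Q \<Longrightarrow> d * sum p (X \<inter> desc u) \<le> sum w (X \<inter> desc u) * c"
  shows "d * sum p (X - Q) \<le> sum w (X - Q) * c"
  using assms(3-)
proof (induction "card (X - Q)" arbitrary: Q rule: less_induct)
  case less
  have finX: "finite X" using assms(1,2) fin unfolding closed_def by (meson finite_subset le_infE)
  show ?case
  proof (cases "X - Q = {}")
    case False
    have "\<exists>v\<in>X - Q. \<forall>x\<in>X - Q. v \<in> desc x \<longrightarrow> x = v"
    proof -
      obtain v where v: "v \<in> X - Q" "\<And>x. (x, v) \<in> E\<^sup>+ \<Longrightarrow> x \<notin> X - Q"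
        using False wf_trancl[OF wf_E] by (meson ex_in_conv wfE_min)
      then show ?thesis by (auto simp: desc_def dest: rtranclD)
    qed
    then obtain v where v: "v \<in> X" "v \<notin> Q" "\<And>x. x \<in> X - Q \<Longrightarrow> v \<in> desc x \<Longrightarrow> x = v" by blast
    define V where "V = X \<inter> desc v"
    have "V \<inter> Q = {}" using v(1,2) less(2) assms(2) unfolding V_def closed_def by blast
    have vr: "v \<in> desc r" using v assms(2) unfolding closed_def by blast
    \<comment> \<open>By \<open>desc_chain\<close> an ancestor of a job in \<open>V\<close> lies
      below \<open>v\<close> or above it; above \<open>v\<close> it is in \<open>Q\<close> or equal
      to \<open>v\<close>, since \<open>v\<close> is topmost.\<close>
    have cl: "closed R r (Q \<union> V)"
    proof -
      have "x \<in> Q \<union> V" if "u \<in> V" "x \<in> R" "x \<in> desc r" "u \<in> desc x" for u x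
      proof -
        have "x \<in> X" using that assms(2) unfolding V_def closed_def by blast
        moreover have "x \<in> desc v \<or> v \<in> desc x"
          using desc_chain[OF vr that(3) _ that(4)] that(1) unfolding V_def by blast
        ultimately show ?thesis using v(1,3) unfolding V_def by blast
      qed
      then show ?thesis using less(2) assms(2) unfolding closed_def V_def by blast
    qed
    have "X - (Q \<union> V) \<subset> X - Q" using v(1,2) desc_refl[of v] unfolding V_def by blast
    then have "d * sum p (X - (Q \<union> V)) \<le> sum w (X - (Q \<union> V)) * c"
      using finX less(3,4) by (intro less(1) cl psubset_card_mono) (auto simp: V_def)
    moreover have "X - Q - V = X - (Q \<union> V)" "(X - Q) \<inter> V = V" using \<open>V \<inter> Q = {}\<close> by (auto simp: V_def)
    then have "sum f (X - Q) = sum f (X - (Q \<union> V)) + sum f V" for f :: "'a \<Rightarrow> nat"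
      using sum_split[of "X - Q" f V] finX by simp
    moreover have "d * sum p V \<le> sum w V * c" using less(4) v by (simp add: V_def)
    ultimately show ?thesis by (simp add: algebra_simps)
  next
    case True
    then show ?thesis by (simp only: sum.empty mult_0 mult_0_right)
  qed
qed

section \<open>Pruning a tree to maximum density\<close>

definition violating :: "'a set \<Rightarrow> 'a \<Rightarrow> bool" where
  "violating T v \<longleftrightarrow> sum w (T \<inter> desc v) * sum p T < sum w T * sum p (T \<inter> desc v)"

text \<open>The loop invariant of pruning: what was cut off earlier cannot improve the density of
  \<open>T\<close>. The last clause is for density 0/0, where the inequality holds trivially and
  says nothing about the jobs outside \<open>T\<close>.\<close>

definition pruned :: "'a set \<Rightarrow> 'a \<Rightarrow> 'a set \<Rightarrow> bool" where
  "pruned R r T \<longleftrightarrow> closed R r T \<and>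
     (\<forall>U. closed R r U \<longrightarrow> sum w (U - T) * sum p T \<le> sum w T * sum p (U - T)) \<and>
     (sum w T = 0 \<longrightarrow> sum p T = 0 \<longrightarrow> sum w (R \<inter> desc r) = 0)"

lemma pruned_full: "pruned R r (R \<inter> desc r)"
proof -
  have "U - (R \<inter> desc r) = {}" if "closed R r U" for U using that unfolding closed_def by blast
  then have "sum f (U - (R \<inter> desc r)) = 0" if "closed R r U" for U and f :: "'a \<Rightarrow> nat"
    using that by (metis sum.empty)
  then show ?thesis unfolding pruned_def by (auto simp: closed_full)
qed

lemma closed_finite: "R \<subseteq> N \<Longrightarrow> closed R r T \<Longrightarrow> finite T"
  using fin finite_subset[of T N] unfolding closed_def by blast

text \<open>Removing a sparser subtree raises the density, so it is enough that a closed
  \<open>U\<close> meets the removed subtree in a part no denser than the old \<open>T\<close>.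
  Minimality gives this: what \<open>U\<close> leaves of the subtree consists of nonviolating
  subtrees and so is at least as dense as \<open>T\<close>, while the subtree as a whole is
  sparser.\<close>

lemma pruned_step:
  assumes R: "R \<subseteq> N" and T: "pruned R r T" and v: "v \<in> T" "violating T v"
    and least: "\<And>u. u \<in> T \<Longrightarrow> violating T u \<Longrightarrow> card (T \<inter> desc v) \<le> card (T \<inter> desc u)"
  shows "pruned R r (T - desc v)"
  unfolding pruned_def
proof (intro conjI allI impI)
  have clT: "closed R r T" using T by (simp add: pruned_def)
  then show cl: "closed R r (T - desc v)" by (rule closed_remove)
  have finT: "finite T" using closed_finite[OF R clT] .
  define P W Pv Wv where "P = sum p T" and "W = sum w T"
    and "Pv = sum p (T \<inter> desc v)" and "Wv = sum w (T \<inter> desc v)"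
  define P' W' where "P' = sum p (T - desc v)" and "W' = sum w (T - desc v)"
  have P: "P = P' + Pv" and W: "W = W' + Wv"
    using sum_split[OF finT] unfolding P_def P'_def Pv_def W_def W'_def Wv_def by blast+
  have viol: "Wv * P < W * Pv" using v(2) by (simp add: violating_def P_def W_def Pv_def Wv_def)
  then have "0 < Pv" by (cases "Pv = 0") auto
  then have "0 < P" using P by simp
  \<comment> \<open>The density strictly increases. Strictness also gives \<open>0 < W'\<close>,
    which settles the last clause of \<open>pruned\<close>.\<close>
  have better': "W * P' < W' * P" using viol unfolding P W add_mult_distrib add_mult_distrib2 by (simp add: mult.commute)
  then have better: "W * P' \<le> W' * P" by simp
  show "sum w (R \<inter> desc r) = 0" if "sum w (T - desc v) = 0"
    using better' that by (simp add: W'_def)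
  fix U assume U: "closed R r U"
  have sub: "sum w (U \<inter> (T \<inter> desc v)) * P \<le> W * sum p (U \<inter> (T \<inter> desc v))"
  proof (cases "v \<in> U")
    case False
    then have "U \<inter> (T \<inter> desc v) = {}"
      using U v(1) clT unfolding closed_def by blast
    then show ?thesis by simp
  next
    case True
    define Q where "Q = (T - desc v) \<union> (U \<inter> T)"
    have "closed R r Q" unfolding Q_def by (intro closed_Un closed_Int cl U clT)
    have TQ: "T - Q = (T \<inter> desc v) - U" unfolding Q_def by blast
    have "W * sum p (T - Q) \<le> sum w (T - Q) * P"
    proof (rule stable_diff[OF R clT \<open>closed R r Q\<close>])
      show "Q \<subseteq> T" by (auto simp: Q_def)
    next
      fix u assume u: "u \<in> T - Q"
      then have uv: "u \<in> T" "u \<in> desc v" "u \<noteq> v" using True TQ by auto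
      have "v \<notin> desc u" using uv desc_antisym by blast
      then have "T \<inter> desc u \<subset> T \<inter> desc v" using v(1) uv desc_trans desc_refl by blast
      then have "card (T \<inter> desc u) < card (T \<inter> desc v)" using finT by (intro psubset_card_mono) auto
      then have "\<not> violating T u" using least[OF uv(1)] by auto
      then show "W * sum p (T \<inter> desc u) \<le> sum w (T \<inter> desc u) * P"
        by (simp add: violating_def P_def W_def)
    qed
    moreover have "sum f (T \<inter> desc v) = sum f (T - Q) + sum f (U \<inter> (T \<inter> desc v))" for f :: "'a \<Rightarrow> nat"
      unfolding TQ using sum_split[of "T \<inter> desc v" f U] finT by (simp add: Int_commute[of U])
    then have "(sum w (T - Q) + sum w (U \<inter> (T \<inter> desc v))) * P
        < W * (sum p (T - Q) + sum p (U \<inter> (T \<inter> desc v)))"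
      using viol unfolding Wv_def Pv_def by simp
    ultimately show ?thesis unfolding add_mult_distrib add_mult_distrib2 by linarith
  qed
  have "U - (T - desc v) = (U - T) \<union> (U \<inter> (T \<inter> desc v))" by blast
  then have split: "sum f (U - (T - desc v)) = sum f (U - T) + sum f (U \<inter> (T \<inter> desc v))" for f :: "'a \<Rightarrow> nat"
    using closed_finite[OF R U] by (simp add: sum.union_disjoint disjoint_iff)
  define p1 w1 where "p1 = sum p (U - (T - desc v))" and "w1 = sum w (U - (T - desc v))"
  have "sum w (U - T) * P \<le> W * sum p (U - T)"
    using T U by (simp add: pruned_def P_def W_def)
  with sub have "w1 * P \<le> W * p1"
    unfolding p1_def w1_def split add_mult_distrib add_mult_distrib2 by linarith
  \<comment> \<open>Both sides are compared through the old density \<open>W / P\<close>; the factor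
    \<open>P\<close> is then cancelled.\<close>
  then have "(w1 * P') * P \<le> W * p1 * P'" using mult_le_mono1[of "w1 * P" "W * p1" P'] by (simp only: ac_simps)
  also have "\<dots> \<le> (W' * p1) * P" using mult_le_mono1[OF better, of p1] by (simp only: ac_simps)
  finally have "w1 * P' \<le> W' * p1" using \<open>0 < P\<close> by simp
  then show "sum w (U - (T - desc v)) * sum p (T - desc v) \<le> sum w (T - desc v) * sum p (U - (T - desc v))"
    unfolding p1_def w1_def P'_def W'_def .
qed

text \<open>Without violating jobs \<open>stable_diff\<close> makes \<open>T - U\<close> at least as
  dense as \<open>T\<close>, so \<open>U \<inter> T\<close> is at most as dense; for
  \<open>U - T\<close> this is the invariant.\<close>

lemma pruned_optimal:
  assumes R: "R \<subseteq> N" and T: "pruned R r T" and "\<And>v. v \<in> T \<Longrightarrow> \<not> violating T v"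
    and U: "closed R r U"
  shows "sum w U * sum p T \<le> sum w T * sum p U"
proof -
  have clT: "closed R r T" using T by (simp add: pruned_def)
  have finT: "finite T" "finite U" using closed_finite[OF R] clT U by auto
  have stab: "sum w T * sum p (T - (U \<inter> T)) \<le> sum w (T - (U \<inter> T)) * sum p T"
    using assms(3) by (intro stable_diff[OF R clT] closed_Int U clT) (auto simp: violating_def not_less)
  have out: "sum w (U - T) * sum p T \<le> sum w T * sum p (U - T)"
    using T U by (simp add: pruned_def)
  have split: "sum f T = sum f (T - (U \<inter> T)) + sum f (U \<inter> T)"
    "sum f U = sum f (U - T) + sum f (U \<inter> T)" for f :: "'a \<Rightarrow> nat"
    using sum_split[OF finT(1), of f "U \<inter> T"] sum_split[OF finT(2), of f T] by (auto simp: Int_absorb1)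
  define W P W1 P1 W2 P2 W3 P3 where "W = sum w T" and "P = sum p T"
    and "W1 = sum w (T - (U \<inter> T))" and "P1 = sum p (T - (U \<inter> T))"
    and "W2 = sum w (U - T)" and "P2 = sum p (U - T)"
    and "W3 = sum w (U \<inter> T)" and "P3 = sum p (U \<inter> T)"
  have "W * P1 \<le> W1 * P" "W2 * P \<le> W * P2" using stab out by (simp_all add: W_def P_def W1_def P1_def W2_def P2_def)
  moreover have WP: "W = W1 + W3" "P = P1 + P3"
    unfolding W_def P_def W1_def P1_def W3_def P3_def by (fact split)+
  moreover have "W3 * (P1 + P3) + (W1 * (P1 + P3)) = (W1 + W3) * P1 + (W1 + W3) * P3"
    by (simp add: algebra_simps)
  ultimately have "(W2 + W3) * P \<le> W * (P2 + P3)" by (simp add: algebra_simps)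
  then show ?thesis unfolding W_def P_def W2_def P2_def W3_def P3_def split(2) .
qed

section \<open>Startable sets and their partition into rooted subtrees\<close>

definition available :: "'a set \<Rightarrow> 'a \<Rightarrow> bool" where
  "available R j \<longleftrightarrow> (\<forall>i. (i, j) \<notin> E) \<or> (\<exists>i. (i, j) \<in> E \<and> i \<notin> R)"

definition startable :: "'a set \<Rightarrow> 'a set \<Rightarrow> bool" where
  "startable R V \<longleftrightarrow> V \<subseteq> R \<and> (\<forall>j\<in>V. available R j \<or> (\<exists>i\<in>V. (i, j) \<in> E))"

lemma startable_ex_available:
  assumes "R \<subseteq> N" "startable R V" "V \<noteq> {}"
  shows "\<exists>r\<in>V. available R r"
proof -
  obtain r where "r \<in> V" "\<And>i. (i, r) \<in> E \<Longrightarrow> i \<notin> V"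
    using assms(3) wf_E by (meson ex_in_conv wfE_min)
  then show ?thesis using assms(2) unfolding startable_def by blast
qed

text \<open>Peel off the jobs reachable from an available root inside \<open>V\<close>. They are
  closed because predecessors below one root are unique, and the rest is startable because none of
  its jobs has a predecessor among those peeled off. Bounds on the density of the parts add
  up.\<close>

lemma startable_bound:
  assumes R: "R \<subseteq> N"
    and bound: "\<And>r U. r \<in> R \<Longrightarrow> available R r \<Longrightarrow> closed R r U \<Longrightarrow> sum w U * c \<le> d * sum p U"
  shows "startable R V \<Longrightarrow> sum w V * c \<le> d * sum p V"
proof (induction "card V" arbitrary: V rule: less_induct)
  case less
  have VR: "V \<subseteq> R" using less(2) by (simp add: startable_def)
  have finV: "finite V" using VR R fin finite_subset by (meson subset_trans)
  show ?case
  proof (cases "V = {}")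
    case False
    then obtain r where r: "r \<in> V" "available R r" using startable_ex_available[OF R less(2)] by blast
    define U where "U = (E \<inter> V \<times> V)\<^sup>* `` {r}"
    have UV: "U \<subseteq> V" unfolding U_def using r(1) by (auto elim: rtranclE)
    have "closed R r U"
    proof -
      \<comment> \<open>Induction along a path inside \<open>V\<close>: an ancestor \<open>x\<close>
        of its end is the end itself or, by \<open>desc_parent\<close>, an ancestor of the vertex
        before it.\<close>
      have "x \<in> U" if "(r, u) \<in> (E \<inter> V \<times> V)\<^sup>*" "x \<in> desc r" "u \<in> desc x" for u x
        using that
      proof (induction rule: rtrancl_induct)
        case base
        then show ?case using desc_antisym by (auto simp: U_def)
      next
        case (step y z)
        have "y \<in> desc r" using step(1) unfolding desc_def
          by (meson ImageI inf_le1 rtrancl_mono singletonI subsetD)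
        show ?case
        proof (cases "x = z")
          case True
          then show ?thesis using step(1,2) by (auto simp: U_def intro: rtrancl_into_rtrancl)
        next
          case False
          then have "y \<in> desc x" using desc_parent[OF step(4,5) \<open>y \<in> desc r\<close>] step(2) by blast
          then show ?thesis using step by blast
        qed
      qed
      moreover have "U \<subseteq> desc r" unfolding U_def desc_def
        by (meson Image_mono inf_le1 order_refl rtrancl_mono)
      ultimately show ?thesis unfolding closed_def using UV VR by (auto simp: U_def)
    qed
    then have 1: "sum w U * c \<le> d * sum p U" using bound r VR by blast
    have "startable R (V - U)"
      unfolding startable_def
    proof (intro conjI ballI)
      show "V - U \<subseteq> R" using VR by blast
      fix j assume j: "j \<in> V - U"
      show "available R j \<or> (\<exists>i\<in>V - U. (i, j) \<in> E)"
      proof (cases "available R j")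
        case False
        then obtain i where i: "i \<in> V" "(i, j) \<in> E" using less(2) j unfolding startable_def by blast
        then have "i \<notin> U" using j by (auto simp: U_def intro: rtrancl_into_rtrancl)
        then show ?thesis using i by blast
      qed simp
    qed
    moreover have "card (V - U) < card V"
      using r(1) finV by (intro psubset_card_mono) (auto simp: U_def)
    ultimately have "sum w (V - U) * c \<le> d * sum p (V - U)" using less(1) by blast
    moreover have "sum f V = sum f (V - U) + sum f U" for f :: "'a \<Rightarrow> nat"
      using sum_split[OF finV, of f U] UV by (simp add: Int_absorb1)
    ultimately show ?thesis using 1 by (simp add: algebra_simps)
  qed simp
qed

text \<open>The predecessor of \<open>j\<close> on a path from \<open>r\<close> either remains, and
  is in \<open>U\<close> by closedness, or is completed and makes \<open>j\<close> available. This
  is why paths may pass through completed jobs.\<close>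

lemma closed_startable:
  assumes R: "R \<subseteq> N" and "closed R r U" "available R r"
  shows "startable R U"
  unfolding startable_def
proof (intro conjI ballI)
  show "U \<subseteq> R" using assms(2) by (auto simp: closed_def)
  fix j assume j: "j \<in> U"
  show "available R j \<or> (\<exists>i\<in>U. (i, j) \<in> E)"
  proof (cases "j = r")
    case False
    have rj: "(r, j) \<in> E\<^sup>*" using j assms(2) by (auto simp: closed_def desc_def)
    then obtain i where i: "(r, i) \<in> E\<^sup>*" "(i, j) \<in> E"
      by (rule rtranclE) (use False in auto)
    show ?thesis
    proof (cases "i \<in> R")
      case True
      moreover have "i \<in> desc r" "j \<in> desc i" using i by (auto simp: desc_def)
      ultimately show ?thesis using i(2) j assms(2) unfolding closed_def by blast
    next
      case False
      then show ?thesis using i(2) unfolding available_def by blast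
    qed
  qed (use assms in simp)
qed

end

section \<open>The greedy schedule\<close>

text \<open>Jobs of positive length are removed by latest completion: no other one can start after
  the last has completed, as it would complete later still. A job of length zero could start at that
  very moment, so these are left out first.\<close>

lemma feasible_load:
  assumes "feasible N p E S" "finite V" "V \<subseteq> N" "\<And>j. j \<in> V \<Longrightarrow> completion p S j \<le> \<tau>"
    "0 \<le> \<tau>" "\<And>j. j \<in> N \<Longrightarrow> 0 \<le> p j"
  shows "sum p V \<le> \<tau>"
proof -
  have pos: "sum p V \<le> \<tau>" if "finite V" "V \<subseteq> N" "\<And>j. j \<in> V \<Longrightarrow> completion p S j \<le> \<tau>"
    "\<And>j. j \<in> V \<Longrightarrow> 0 < p j" "0 \<le> \<tau>" for V \<tau>
    using that
  proof (induction "card V" arbitrary: V \<tau>)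
    case 0
    then show ?case by simp
  next
    case (Suc m)
    then have "V \<noteq> {}" by auto
    then obtain j where j: "j \<in> V" "\<And>i. i \<in> V \<Longrightarrow> completion p S i \<le> completion p S j"
    proof -
      have "Max (completion p S ` V) \<in> completion p S ` V" using Suc(3) \<open>V \<noteq> {}\<close> by (intro Max_in) auto
      then obtain j where "j \<in> V" "completion p S j = Max (completion p S ` V)" by (metis imageE)
      then show thesis using Suc(3) by (intro that[of j]) auto
    qed
    have "completion p S i \<le> S j" if "i \<in> V - {j}" for i
    proof (rule ccontr)
      assume "\<not> completion p S i \<le> S j"
      then have "completion p S j \<le> S i"
        using assms(1) that j(1) Suc(4) unfolding feasible_def by (metis DiffD1 DiffD2 insertI1 subsetD)
      then show False using j(2)[of i] Suc(6)[of i] that by (simp add: completion_def)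
    qed
    moreover have "0 \<le> S j" using assms(1) j(1) Suc(4) by (auto simp: feasible_def)
    ultimately have "sum p (V - {j}) \<le> S j" using Suc(2-6) j(1) by (intro Suc(1)) auto
    moreover have "sum p V = p j + sum p (V - {j})" using Suc(3) j(1) by (simp add: sum.remove)
    moreover have "S j + p j \<le> \<tau>" using Suc(5)[OF j(1)] by (simp add: completion_def)
    ultimately show ?case by simp
  qed
  have "sum p {j \<in> V. 0 < p j} \<le> \<tau>"
    using assms(2-5) by (intro pos) (simp_all add: subset_iff)
  moreover have "sum p {j \<in> V. 0 < p j} = sum p V"
  proof (rule sum.mono_neutral_left[OF assms(2)])
    show "\<forall>i\<in>V - {j \<in> V. 0 < p j}. p i = 0"
    proof
      fix i assume "i \<in> V - {j \<in> V. 0 < p j}"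
      then show "p i = 0" using assms(3) assms(6)[of i] by auto
    qed
  qed blast
  ultimately show ?thesis by simp
qed

section \<open>The charging argument\<close>

context weighted_multitree
begin

abbreviation "pr \<equiv> (\<lambda>j. real (p j))"
abbreviation "wr \<equiv> (\<lambda>j. real (w j))"

text \<open>A block with \<open>sum p U = 0\<close> delays nobody, so nothing is required of its
  density.\<close>

definition greedy :: "'a set \<Rightarrow> 'a set \<Rightarrow> bool" where
  "greedy R U \<longleftrightarrow> startable R U \<and>
     (sum p U = 0 \<or> (\<forall>V. startable R V \<longrightarrow> sum w V * sum p U \<le> sum w U * sum p V))"

text \<open>
  \<open>A\<close> is the weighted completion time of the jobs completed by time \<open>t\<close>, and \<open>B\<close> what is left of
  the current block. The right-hand side is four times the part of the optimum's objective that
  is incurred up to time \<open>\<Phi> / 2\<close>; \<open>\<Phi>\<close> is the maximum over the blocks so far of the weight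
  of the remaining jobs divided by the density of the block.
\<close>

definition charged :: "'a set \<Rightarrow> 'a set \<Rightarrow> nat \<Rightarrow> nat \<Rightarrow> bool" where
  "charged R B t A \<longleftrightarrow> (\<forall>S. feasible N pr E S \<longrightarrow>
     (\<exists>\<Phi>\<ge>0. real A + real (t + sum p B) * real (sum w R) + \<Phi> * real (sum w (R - B))
        \<le> 4 * (\<Sum>j\<in>N. wr j * min (completion pr S j) (\<Phi> / 2))))"

lemma completion_nonneg: "feasible N pr E S \<Longrightarrow> j \<in> N \<Longrightarrow> 0 \<le> completion pr S j"
  by (simp add: feasible_def completion_def)

lemma charged_start: "charged N {} 0 0"
  unfolding charged_def
  by (intro allI impI exI[of _ 0]) (auto intro!: sum_nonneg simp: completion_nonneg)

text \<open>The left side already charges every remaining job with the end of the block, so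
  replacing this by the actual completion time of \<open>j\<close> can only lower it.\<close>

lemma charged_run:
  assumes "charged R B t A" "j \<in> B" "B \<subseteq> R" "R \<subseteq> N"
  shows "charged (R - {j}) (B - {j}) (t + p j) (A + w j * (t + p j))"
  unfolding charged_def
proof (intro allI impI)
  fix S assume "feasible N pr E S"
  then obtain \<Phi> where \<Phi>: "0 \<le> \<Phi>"
    "real A + real (t + sum p B) * real (sum w R) + \<Phi> * real (sum w (R - B))
        \<le> 4 * (\<Sum>j\<in>N. wr j * min (completion pr S j) (\<Phi> / 2))"
    using assms(1) unfolding charged_def by blast
  have f: "finite R" "finite B" using assms fin by (meson finite_subset)+
  have "sum p B = p j + sum p (B - {j})" "sum w R = w j + sum w (R - {j})"
    using f assms by (auto simp: sum.remove)
  moreover have "R - {j} - (B - {j}) = R - B" using assms(2) by blast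
  moreover have "A + w j * (t + p j) + (t + p j + b) * c \<le> A + (t + (p j + b)) * (w j + c)" for b c
    by (simp add: algebra_simps)
  ultimately have "A + w j * (t + p j) + (t + p j + sum p (B - {j})) * sum w (R - {j})
      \<le> A + (t + sum p B) * sum w R" by simp
  then have "real (A + w j * (t + p j)) + real (t + p j + sum p (B - {j})) * real (sum w (R - {j}))
      \<le> real A + real (t + sum p B) * real (sum w R)"
    unfolding of_nat_mult[symmetric] of_nat_add[symmetric] of_nat_le_iff .
  then show "\<exists>\<Phi>\<ge>0. real (A + w j * (t + p j)) + real (t + p j + sum p (B - {j})) * real (sum w (R - {j})) +
       \<Phi> * real (sum w (R - {j} - (B - {j}))) \<le> 4 * (\<Sum>j\<in>N. wr j * min (completion pr S j) (\<Phi> / 2))"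
    using \<Phi> \<open>R - {j} - (B - {j}) = R - B\<close> by (intro exI[of _ \<Phi>]) simp
qed

text \<open>The predecessor that permits a job to start completes no later than the job, so it is in
  the set as well or no longer in \<open>R\<close>. This is how the precedence constraints on a
  competing schedule enter the bound.\<close>

lemma startable_early:
  assumes "feasible N pr E S" "R \<subseteq> N"
  shows "startable R {j \<in> R. completion pr S j < \<tau>}"
  unfolding startable_def
proof (intro conjI ballI)
  fix j assume j: "j \<in> {j \<in> R. completion pr S j < \<tau>}"
  show "available R j \<or> (\<exists>i\<in>{j \<in> R. completion pr S j < \<tau>}. (i, j) \<in> E)"
  proof (cases "\<exists>i. (i, j) \<in> E")
    case True
    then obtain i where i: "(i, j) \<in> E" "completion pr S i \<le> S j"
      using assms j unfolding feasible_def by blast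
    then have "completion pr S i < \<tau>" using j by (simp add: completion_def)
    then show ?thesis using i unfolding available_def by blast
  qed (simp add: available_def)
qed blast

lemma startable_all: "startable R R"
  unfolding startable_def available_def by blast

text \<open>The block adds \<open>P * W = \<phi> * WU\<close> to the left side. If
  \<open>\<phi> \<le> \<Phi>\<close>, the reserve \<open>\<Phi> * WU\<close> that is released pays
  for it. Otherwise \<Phi> is raised to \<phi>, which costs \<open>(\<phi> - \<Phi>) * W\<close>; at
  least the weight \<open>W / 2\<close> is not completed before \<open>\<phi> / 2\<close>, and it
  gains \<open>(\<phi> - \<Phi>) / 2\<close> under the minimum. Hence the factor 4.\<close>

lemma charged_select:
  assumes "charged R {} t A" "greedy R U" "R \<subseteq> N"
  shows "charged R U t A"
  unfolding charged_def
proof (intro allI impI)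
  fix S assume S: "feasible N pr E S"
  then obtain \<Phi> where \<Phi>: "0 \<le> \<Phi>"
    "real A + real t * real (sum w R) + \<Phi> * real (sum w R)
        \<le> 4 * (\<Sum>j\<in>N. wr j * min (completion pr S j) (\<Phi> / 2))"
    using assms(1) unfolding charged_def by auto
  have UR: "U \<subseteq> R" using assms(2) by (simp add: greedy_def startable_def)
  have f: "finite R" using assms fin by (meson finite_subset)
  define W WU P where "W = real (sum w R)" and "WU = real (sum w U)" and "P = real (sum p U)"
  have nn: "0 \<le> W" "0 \<le> WU" "0 \<le> P" unfolding W_def WU_def P_def by (rule of_nat_0_le_iff)+
  have diff: "real (sum w (R - U)) = W - WU"
  proof -
    have "R \<inter> U = U" using UR by blast
    then show ?thesis using sum_split[OF f, of w U] unfolding W_def WU_def by simp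
  qed
  have opt: "sum w V * sum p U \<le> sum w U * sum p V" if "startable R V" "P \<noteq> 0" for V
    using assms(2) that unfolding greedy_def P_def by auto
  have zero: "P * W = 0" if "WU = 0"
  proof (cases "P = 0")
    case False
    have "sum w U = 0" using that unfolding WU_def by (simp only: of_nat_eq_0_iff)
    then have "sum w R * sum p U = 0" using opt[OF startable_all False] by simp
    then show ?thesis unfolding P_def W_def of_nat_mult[symmetric] by (simp only: mult.commute of_nat_0)
  qed simp
  \<comment> \<open>For \<open>WU = 0\<close> the division yields 0, which is the right value
    because then \<open>P * W = 0\<close>.\<close>
  define \<phi> where "\<phi> = W * P / WU"
  have \<phi>WU: "\<phi> * WU = P * W" using zero by (cases "WU = 0") (auto simp: \<phi>_def)
  show "\<exists>\<Phi>\<ge>0. real A + real (t + sum p U) * real (sum w R) + \<Phi> * real (sum w (R - U))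
        \<le> 4 * (\<Sum>j\<in>N. wr j * min (completion pr S j) (\<Phi> / 2))"
  proof (cases "\<phi> \<le> \<Phi>")
    case True
    then have "\<phi> * WU \<le> \<Phi> * WU" using nn by (intro mult_right_mono)
    then have "real A + (real t + P) * W + \<Phi> * (W - WU) \<le> real A + real t * W + \<Phi> * W"
      using \<phi>WU by (simp add: algebra_simps)
    then show ?thesis using \<Phi> unfolding diff of_nat_add W_def[symmetric] P_def[symmetric]
      by (intro exI[of _ \<Phi>] conjI) linarith+
  next
    case False
    then have pos: "0 < \<phi>" using \<Phi>(1) by simp
    then have pos': "0 < P" "0 < WU" "0 < W" using nn by (auto simp: \<phi>_def zero_less_divide_iff zero_less_mult_iff)
    \<comment> \<open>The inequality is strict so that the jobs of \<open>R - V\<close> attain the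
      cap \<open>\<phi> / 2\<close>, and with it the smaller cap \<open>\<Phi> / 2\<close>.\<close>
    define V where "V = {j \<in> R. completion pr S j < \<phi> / 2}"
    have "sum pr V \<le> \<phi> / 2"
      using S assms(3) pos f by (intro feasible_load[OF S]) (auto simp: V_def)
    then have "real (sum p V) \<le> \<phi> / 2" by simp
    have "real (sum w V) * P \<le> WU * real (sum p V)"
      using opt[OF startable_early[OF S assms(3)], of "\<phi> / 2"] pos'(1)
      unfolding V_def[symmetric] P_def WU_def of_nat_mult[symmetric] of_nat_le_iff by simp
    also have "\<dots> \<le> WU * (\<phi> / 2)" using \<open>real (sum p V) \<le> \<phi> / 2\<close> nn by (intro mult_left_mono)
    also have "\<dots> = W / 2 * P" using \<phi>WU by (simp add: algebra_simps)
    finally have "real (sum w V) \<le> W / 2" using pos'(1) by simp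
    moreover have "W = real (sum w V) + real (sum w (R - V))"
    proof -
      have "R \<inter> V = V" by (auto simp: V_def)
      then show ?thesis using sum_split[OF f, of w V] unfolding W_def by simp
    qed
    ultimately have late: "W / 2 \<le> real (sum w (R - V))" by simp
    have "(\<phi> - \<Phi>) / 2 * (W / 2) \<le> (\<phi> - \<Phi>) / 2 * real (sum w (R - V))"
      using late False by (intro mult_left_mono) auto
    also have "\<dots> = (\<Sum>j\<in>R - V. wr j * ((\<phi> - \<Phi>) / 2))" by (simp add: sum_distrib_left mult.commute)
    also have "\<dots> = (\<Sum>j\<in>R - V. wr j * (min (completion pr S j) (\<phi> / 2) - min (completion pr S j) (\<Phi> / 2)))"
      using False by (intro sum.cong) (auto simp: V_def min_def field_simps)
    also have "\<dots> \<le> (\<Sum>j\<in>N. wr j * (min (completion pr S j) (\<phi> / 2) - min (completion pr S j) (\<Phi> / 2)))"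
      using False assms(3) fin by (intro sum_mono2) (auto intro!: mult_nonneg_nonneg simp: min_def)
    finally have "(\<phi> - \<Phi>) * W \<le> 4 * (\<Sum>j\<in>N. wr j * min (completion pr S j) (\<phi> / 2))
        - 4 * (\<Sum>j\<in>N. wr j * min (completion pr S j) (\<Phi> / 2))"
      by (simp add: right_diff_distrib sum_subtractf)
    moreover have "real A + (real t + P) * W + \<phi> * (W - WU) = real A + real t * W + \<Phi> * W + (\<phi> - \<Phi>) * W"
      using \<phi>WU by (simp add: algebra_simps)
    ultimately show ?thesis using \<Phi>(2) pos unfolding diff of_nat_add W_def[symmetric] P_def[symmetric]
      by (intro exI[of _ \<phi>] conjI) linarith+
  qed
qed

section \<open>The invariant of the greedy schedule\<close>

definition partial_schedule :: "'a set \<Rightarrow> nat \<Rightarrow> ('a \<Rightarrow> nat) \<Rightarrow> bool" where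
  "partial_schedule R t S \<longleftrightarrow> (\<forall>j\<in>N - R. S j + p j \<le> t) \<and>
     (\<forall>i\<in>N - R. \<forall>j\<in>N - R. i \<noteq> j \<longrightarrow> S i + p i \<le> S j \<or> S j + p j \<le> S i) \<and>
     (\<forall>j\<in>N - R. (\<exists>i. (i, j) \<in> E) \<longrightarrow> (\<exists>i\<in>N - R. (i, j) \<in> E \<and> S i + p i \<le> S j))"

text \<open>The equation for \<open>t\<close>, absence of idle time, is what later keeps the start
  times below the memory bound.\<close>

definition greedy_state :: "'a set \<Rightarrow> 'a set \<Rightarrow> nat \<Rightarrow> ('a \<Rightarrow> nat) \<Rightarrow> bool" where
  "greedy_state R B t S \<longleftrightarrow> R \<subseteq> N \<and> startable R B \<and> partial_schedule R t S \<and> t = sum p (N - R) \<and>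
     charged R B t (\<Sum>j\<in>N - R. w j * (S j + p j))"

lemma greedy_state_start: "greedy_state N {} 0 S"
  using charged_start by (simp add: greedy_state_def partial_schedule_def startable_def)

lemma greedy_state_select:
  "greedy_state R {} t S \<Longrightarrow> greedy R U \<Longrightarrow> greedy_state R U t S"
  using charged_select by (auto simp: greedy_state_def greedy_def)

lemma greedy_state_run:
  assumes "greedy_state R B t S" "j \<in> B" "available R j"
  shows "greedy_state (R - {j}) (B - {j}) (t + p j) (S(j := t))"
proof -
  have R: "R \<subseteq> N" and B: "startable R B" "B \<subseteq> R" and S: "partial_schedule R t S"
    and ch: "charged R B t (\<Sum>j\<in>N - R. w j * (S j + p j))" and t: "t = sum p (N - R)"
    using assms(1) by (auto simp: greedy_state_def startable_def)
  have j: "j \<in> N" "j \<in> R" using assms(2) B R by auto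
  have N: "N - (R - {j}) = insert j (N - R)" using j by blast
  have "startable (R - {j}) (B - {j})"
    using B(1) unfolding startable_def available_def by blast
  moreover have "partial_schedule (R - {j}) (t + p j) (S(j := t))"
  proof -
    have pred: "\<exists>i\<in>N - R. (i, j) \<in> E \<and> S i + p i \<le> t" if "(i, j) \<in> E" for i
      using that assms(3) S E_sub unfolding available_def partial_schedule_def by blast
    show ?thesis
      unfolding partial_schedule_def N
    proof (intro conjI ballI impI)
      fix i assume i: "i \<in> insert j (N - R)"
      show "(S(j := t)) i + p i \<le> t + p j"
        using i j S by (auto simp: partial_schedule_def trans_le_add1)
      show "(S(j := t)) i + p i \<le> (S(j := t)) k \<or> (S(j := t)) k + p k \<le> (S(j := t)) i"
        if "k \<in> insert j (N - R)" "i \<noteq> k" for k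
        using i that j S by (auto simp: partial_schedule_def)
      show "\<exists>k\<in>insert j (N - R). (k, i) \<in> E \<and> (S(j := t)) k + p k \<le> (S(j := t)) i" if "\<exists>k. (k, i) \<in> E"
      proof (cases "i = j")
        case True
        then obtain k where "k \<in> N - R" "(k, i) \<in> E" "S k + p k \<le> t"
          using pred \<open>\<exists>k. (k, i) \<in> E\<close> by blast
        moreover from this have "k \<noteq> j" using j by blast
        ultimately show ?thesis using True by (intro bexI[of _ k]) auto
      next
        case False
        then obtain k where "k \<in> N - R" "(k, i) \<in> E" "S k + p k \<le> S i"
          using i S \<open>\<exists>k. (k, i) \<in> E\<close> unfolding partial_schedule_def by (metis insertE)
        moreover from this have "k \<noteq> j" using j by blast
        ultimately show ?thesis using False by (intro bexI[of _ k]) auto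
      qed
    qed
  qed
  moreover have "(\<Sum>i\<in>N - (R - {j}). w i * ((S(j := t)) i + p i)) = (\<Sum>j\<in>N - R. w j * (S j + p j)) + w j * (t + p j)"
  proof -
    have "(\<Sum>i\<in>N - R. w i * ((S(j := t)) i + p i)) = (\<Sum>i\<in>N - R. w i * (S i + p i))"
      using j by (intro sum.cong) auto
    then show ?thesis unfolding N using fin j by (simp add: add.commute)
  qed
  moreover have "t + p j = sum p (N - (R - {j}))" unfolding N using fin j t by simp
  ultimately show ?thesis
    using charged_run[OF ch assms(2) B(2) R] R unfolding greedy_state_def by auto
qed

text \<open>With no remaining jobs the left side of \<open>charged\<close> is the objective, and
  dropping the cap \<open>\<Phi> / 2\<close> on the right can only increase that side.\<close>

lemma greedy_state_finish:
  assumes "greedy_state {} B t S"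
  shows "feasible N pr E (\<lambda>j. real (S j))"
    and "feasible N pr E S' \<Longrightarrow> objective N pr wr (\<lambda>j. real (S j)) \<le> 4 * objective N pr wr S'"
proof -
  have S: "partial_schedule {} t S" and ch: "charged {} B t (\<Sum>j\<in>N. w j * (S j + p j))"
    using assms by (auto simp: greedy_state_def)
  show "feasible N pr E (\<lambda>j. real (S j))"
    using S unfolding feasible_def partial_schedule_def completion_def of_nat_add[symmetric] of_nat_le_iff
    by auto
  assume S': "feasible N pr E S'"
  then obtain \<Phi> where "real (\<Sum>j\<in>N. w j * (S j + p j)) \<le> 4 * (\<Sum>j\<in>N. wr j * min (completion pr S' j) (\<Phi> / 2))"
    using ch unfolding charged_def by auto
  also have "\<dots> \<le> 4 * (\<Sum>j\<in>N. wr j * completion pr S' j)"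
    by (intro mult_left_mono sum_mono) auto
  finally show "objective N pr wr (\<lambda>j. real (S j)) \<le> 4 * objective N pr wr S'"
    by (simp add: objective_def completion_def)
qed

text \<open>
  The first alternative occurs only if the first root has a tree without weight and processing time.
\<close>

definition best_tree :: "'a set \<Rightarrow> 'a set \<Rightarrow> 'a set \<Rightarrow> bool" where
  "best_tree R K U \<longleftrightarrow> startable R U \<and> U \<noteq> {} \<and> (sum w U = 0 \<and> sum p U = 0 \<or>
     (\<forall>r\<in>K. \<forall>V. closed R r V \<longrightarrow> sum w V * sum p U \<le> sum w U * sum p V))"

lemma cross_mult_trans:
  fixes a b c d e f :: nat
  assumes "a * d \<le> c * b" "c * f \<le> e * d" "0 < d"
  shows "a * f \<le> e * b"
proof -
  have "a * d * f \<le> c * b * f" using assms(1) by (rule mult_le_mono1)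
  also have "\<dots> = c * f * b" by simp
  also have "\<dots> \<le> e * d * b" using assms(2) by (rule mult_le_mono1)
  finally have "(a * f) * d \<le> (e * b) * d" by (simp only: ac_simps)
  then show ?thesis using assms(3) by simp
qed

lemma best_tree_first:
  assumes "R \<subseteq> N" "pruned R r T" "\<And>v. v \<in> T \<Longrightarrow> \<not> violating T v" "T \<noteq> {}" "available R r"
  shows "best_tree R {r} T"
  using pruned_optimal[OF assms(1-3)] closed_startable[OF assms(1) _ assms(5)] assms(2,4)
  unfolding best_tree_def by (auto simp: pruned_def)

text \<open>The strict inequality forces \<open>0 < sum p U\<close>, which makes comparison through
  \<open>U\<close> transitive.\<close>

lemma best_tree_replace:
  assumes "best_tree R K U" "best_tree R {r} T" "sum w U * sum p T < sum w T * sum p U"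
  shows "best_tree R (insert r K) T"
proof -
  have "0 < sum p U" "\<not> (sum w T = 0 \<and> sum p T = 0)" using assms(3) by (auto intro: gr0I)
  moreover have "sum w V * sum p T \<le> sum w T * sum p V" if "r' \<in> K" "closed R r' V" for r' V
  proof (rule cross_mult_trans)
    show "sum w V * sum p U \<le> sum w U * sum p V"
      using assms(1) that \<open>0 < sum p U\<close> unfolding best_tree_def by auto
    show "sum w U * sum p T \<le> sum w T * sum p U" using assms(3) by (rule less_imp_le)
  qed fact
  ultimately show ?thesis using assms(2) unfolding best_tree_def by auto
qed

text \<open>Comparison through \<open>T\<close> is transitive unless \<open>sum p T = 0\<close>. In
  that case either \<open>T\<close> is weightless too, and by the last clause of
  \<open>pruned\<close> so are all trees of \<open>r\<close>, or \<open>le\<close> forces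
  \<open>sum p U = 0\<close>.\<close>

lemma best_tree_keep:
  assumes "R \<subseteq> N" "best_tree R K U" "pruned R r T" "\<And>v. v \<in> T \<Longrightarrow> \<not> violating T v"
    and le: "sum w T * sum p U \<le> sum w U * sum p T"
  shows "best_tree R (insert r K) U"
proof -
  have "sum w V * sum p U \<le> sum w U * sum p V"
    if V: "closed R r V" and U: "\<not> (sum w U = 0 \<and> sum p U = 0)" for V
  proof (cases "sum p T = 0")
    case False
    then have "0 < sum p T" by (rule neq0_conv[THEN iffD1])
    show ?thesis by (rule cross_mult_trans[OF pruned_optimal[OF assms(1,3,4) V] le \<open>0 < sum p T\<close>])
  next
    case True
    show ?thesis
    proof (cases "sum w T = 0")
      case T: True
      have "sum w V \<le> sum w (R \<inter> desc r)"
        using V fin assms(1) unfolding closed_def by (intro sum_mono2) (auto intro: finite_subset)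
      also have "\<dots> = 0" using assms(3) True T by (simp add: pruned_def)
      finally have "sum w V = 0" by (simp only: le_zero_eq)
      then show ?thesis by (simp only: mult_0 le0)
    next
      case False
      then have "sum p U = 0" using True le by (metis bot_nat_0.extremum_uniqueI mult_0_right mult_is_0)
      then show ?thesis by (simp only: mult_0_right le0)
    qed
  qed
  then show ?thesis using assms(2) unfolding best_tree_def
    by (cases "sum w U = 0 \<and> sum p U = 0") auto
qed

text \<open>\<open>startable_bound\<close> extends optimality from trees to all startable
  sets.\<close>

lemma best_tree_greedy:
  assumes "R \<subseteq> N" "best_tree R {r \<in> R. available R r} U"
  shows "greedy R U"
  using assms startable_bound[OF assms(1), of "sum p U" "sum w U"]
  unfolding best_tree_def greedy_def by auto

end

section \<open>The program\<close>

abbreviation Num_of_jobs :: aexp where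
  "Num_of_jobs \<equiv> Var ''n''"

abbreviation At :: "vname \<Rightarrow> vname \<Rightarrow> aexp" where
  "At x i \<equiv> Cell x (Var i)"

abbreviation Reach :: "vname \<Rightarrow> vname \<Rightarrow> aexp" where
  "Reach i j \<equiv> Cell ''r'' (Plus (Times (Var i) Num_of_jobs) (Var j))"

text \<open>Cell 0 holds the length of the input list, cell 1 the number of jobs and the next
  \<open>4 * n\<close> cells the rational data, so the matrix begins at
  \<open>2 + 4 * n\<close>.\<close>

abbreviation Edge :: "vname \<Rightarrow> vname \<Rightarrow> aexp" where
  "Edge i j \<equiv> Cell ''in'' (Plus (Num 2) (Plus (Times (Num 4) Num_of_jobs)
     (Plus (Times Num_of_jobs (Var i)) (Var j))))"

abbreviation Incr :: "vname \<Rightarrow> aexp \<Rightarrow> com" where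
  "Incr x e \<equiv> Set x (Plus (Var x) e)"

abbreviation Positive :: "aexp \<Rightarrow> bexp" where
  "Positive e \<equiv> Less (Num 0) e"

definition Sum_tree :: com where
  "Sum_tree = Seq (Set ''tw'' (Num 0)) (Seq (Set ''tp'' (Num 0))
     (For ''u'' (Seq (Incr ''tw'' (Times (At ''T'' ''u'') (At ''w'' ''u'')))
       (Incr ''tp'' (Times (At ''T'' ''u'') (At ''p'' ''u''))))))"

definition Sum_subtree :: com where
  "Sum_subtree = Seq (Set ''x'' (Num 0)) (Seq (Set ''y'' (Num 0)) (Seq (Set ''z'' (Num 0))
     (For ''u'' (Seq (Incr ''x'' (Times (Times (At ''T'' ''u'') (Reach ''v'' ''u'')) (At ''w'' ''u'')))
       (Seq (Incr ''y'' (Times (Times (At ''T'' ''u'') (Reach ''v'' ''u'')) (At ''p'' ''u'')))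
       (Incr ''z'' (Times (At ''T'' ''u'') (Reach ''v'' ''u''))))))))"

text \<open>\<open>''b''\<close> is the candidate, with \<open>n\<close> for none, and
  \<open>''c''\<close> the size of its subtree; the initial \<open>n + 1\<close> exceeds every
  size.\<close>

definition Find_violating :: com where
  "Find_violating = Seq (Set ''c'' (Plus Num_of_jobs (Num 1))) (Seq (Set ''b'' Num_of_jobs)
     (For ''v'' (If (Positive (At ''T'' ''v''))
       (Seq Sum_subtree
         (If (And (Less (Times (Var ''x'') (Var ''tp'')) (Times (Var ''tw'') (Var ''y''))) (Less (Var ''z'') (Var ''c'')))
           (Seq (Set ''c'' (Var ''z'')) (Set ''b'' (Var ''v''))) Skip))
       Skip)))"

text \<open>Truncated subtraction of 0/1 values is set difference.\<close>

definition Prune_round :: com where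
  "Prune_round = Seq Sum_tree (Seq Find_violating
     (If (Less (Var ''b'') Num_of_jobs)
       (For ''u'' (Assign ''T'' (Var ''u'') (Minus (At ''T'' ''u'') (Reach ''b'' ''u''))))
       Skip))"

text \<open>\<open>''j''\<close> is the root of the best tree so far, with \<open>n\<close> for
  none, its value on entry. This root is available and belongs to the block, so the caller can run
  it without picking again.\<close>

definition Find_block :: com where
  "Find_block = For ''q'' (If (Positive (Times (At ''a'' ''q'') (At ''R'' ''q'')))
     (Seq (For ''v'' (Assign ''T'' (Var ''v'') (Times (Reach ''q'' ''v'') (At ''R'' ''v''))))
     (Seq (For ''m'' Prune_round)
     (Seq Sum_tree
       (If (Not (And (Less (Var ''j'') Num_of_jobs)
            (Not (Less (Times (Var ''bw'') (Var ''tp'')) (Times (Var ''tw'') (Var ''bp''))))))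
         (Seq (Set ''j'' (Var ''q'')) (Seq (Set ''bw'' (Var ''tw'')) (Seq (Set ''bp'' (Var ''tp''))
           (For ''v'' (Assign ''B'' (Var ''v'') (At ''T'' ''v''))))))
         Skip))))
     Skip)"

definition Pick_job :: com where
  "Pick_job = Seq (Set ''j'' Num_of_jobs)
     (For ''i'' (If (Positive (Times (At ''B'' ''i'') (At ''a'' ''i''))) (Set ''j'' (Var ''i'')) Skip))"

text \<open>The clock counts in units of \<open>1 / P\<close>, so all start times get the
  denominator \<open>P\<close>. One completed predecessor suffices, hence all successors become
  available.\<close>

definition Run_job :: com where
  "Run_job = Seq (Assign ''out'' (Plus (Num 1) (Times (Num 2) (Var ''j''))) (Var ''t''))
     (Seq (Assign ''out'' (Plus (Num 2) (Times (Num 2) (Var ''j''))) (Var ''P''))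
     (Seq (Incr ''t'' (At ''p'' ''j''))
     (Seq (Assign ''R'' (Var ''j'') (Num 0))
     (Seq (Assign ''B'' (Var ''j'') (Num 0))
       (For ''i'' (If (Positive (Edge ''j'' ''i'')) (Assign ''a'' (Var ''i'') (Num 1)) Skip))))))"

text \<open>One job per round. A new block is sought only if the current one has no available job,
  which by \<open>startable_ex_available\<close> means that it is empty.\<close>

definition Greedy :: com where
  "Greedy = For ''k'' (Seq Pick_job (Seq (If (Less (Var ''j'') Num_of_jobs) Skip Find_block) Run_job))"

lemma writes_program [simp]:
  "writes Sum_tree = {''tw'', ''tp'', ''u''}"
  "writes Sum_subtree = {''x'', ''y'', ''z'', ''u''}"
  "writes Find_violating = {''c'', ''b'', ''v'', ''x'', ''y'', ''z'', ''u''}"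
  "writes Prune_round = {''tw'', ''tp'', ''u'', ''c'', ''b'', ''v'', ''x'', ''y'', ''z'', ''T''}"
  "writes Find_block = {''q'', ''v'', ''T'', ''m'', ''tw'', ''tp'', ''u'', ''c'', ''b'', ''x'', ''y'', ''z'', ''j'', ''bw'', ''bp'', ''B''}"
  "writes Pick_job = {''j'', ''i''}"
  "writes Run_job = {''out'', ''t'', ''R'', ''B'', ''a'', ''i''}"
  unfolding Sum_tree_def Sum_subtree_def Find_violating_def Prune_round_def Find_block_def
    Pick_job_def Run_job_def by auto

section \<open>Correctness of the greedy program\<close>

context bounded_machine
begin

lemma wp_Seq_Assign:
  assumes "bounded s \<Longrightarrow> aval b s < 2 ^ \<kappa>" "wp d Q (s(x := (s x)(aval a s := aval b s)))"
  shows "wp (Seq (Assign x a b) d) Q s"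
  using assms(2) by (intro wp_Seq[where R = "\<lambda>s'. s' = s(x := (s x)(aval a s := aval b s))"] wp_Assign assms(1)) auto

lemma wp_bounded: "(bounded s \<Longrightarrow> wp c Q s) \<Longrightarrow> wp c Q s"
  by (auto simp: wp_def)

lemma one_less [simp]: "Suc 0 < 2 ^ \<kappa>"
  using two_le_power[of 1] by simp

lemma bounded_less [simp]: "bounded s \<Longrightarrow> s x i < 2 ^ \<kappa>"
  by (simp add: bounded_def)

end

text \<open>\<open>n_bound\<close> makes room for the sentinel \<open>n + 1\<close> and the output
  length \<open>2 * n\<close>, the other two bounds for the partial sums and the clock.\<close>

locale or_program = bounded_machine \<kappa> N + weighted_multitree "{..<n}" E p w
  for \<kappa> N n :: nat and E p w +
  assumes n_le: "n \<le> N" and n_bound: "2 * n + 1 < 2 ^ \<kappa>"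
    and p_bound: "sum p {..<n} < 2 ^ \<kappa>" and w_bound: "sum w {..<n} < 2 ^ \<kappa>"
begin

definition agrees :: "(nat \<Rightarrow> nat) \<Rightarrow> (nat \<Rightarrow> nat) \<Rightarrow> bool" where
  "agrees f g \<longleftrightarrow> (\<forall>i<n. f i = g i)"

definition indicates :: "(nat \<Rightarrow> nat) \<Rightarrow> nat set \<Rightarrow> bool" where
  "indicates f S \<longleftrightarrow> (\<forall>i<n. f i = of_bool (i \<in> S))"

definition closure_matrix :: "(nat \<Rightarrow> nat) \<Rightarrow> bool" where
  "closure_matrix f \<longleftrightarrow> (\<forall>i<n. \<forall>j<n. f (i * n + j) = of_bool (j \<in> desc i))"

definition adjacency_matrix :: "(nat \<Rightarrow> nat) \<Rightarrow> bool" where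
  "adjacency_matrix f \<longleftrightarrow> (\<forall>i<n. \<forall>j<n. f (2 + (4 * n + (n * i + j))) = of_bool ((i, j) \<in> E))"

abbreviation data :: "memory \<Rightarrow> bool" where
  "data s \<equiv> s ''n'' 0 = n \<and> agrees (s ''p'') p \<and> agrees (s ''w'') w \<and> closure_matrix (s ''r'')"

lemma sum_bound_p [simp]: "sum p (T \<inter> {..<k}) < 2 ^ \<kappa>" if "k \<le> n"
proof -
  have "sum p (T \<inter> {..<k}) \<le> sum p {..<n}" using that by (intro sum_mono2) auto
  then show ?thesis using p_bound by simp
qed

lemma sum_bound_w [simp]: "sum w (T \<inter> {..<k}) < 2 ^ \<kappa>" if "k \<le> n"
proof -
  have "sum w (T \<inter> {..<k}) \<le> sum w {..<n}" using that by (intro sum_mono2) auto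
  then show ?thesis using w_bound by simp
qed

lemma card_bound [simp]: "card (T \<inter> {..<k}) < 2 ^ \<kappa>" if "k \<le> n"
proof -
  have "card (T \<inter> {..<k}) \<le> card {..<n}" using that by (intro card_mono) auto
  then show ?thesis using n_bound by simp
qed

lemma Int_lessThan_Suc: "T \<inter> {..<Suc k} = (if k \<in> T then insert k (T \<inter> {..<k}) else T \<inter> {..<k})"
  by (auto simp: less_Suc_eq)

lemma sum_Int_Suc: "sum f (T \<inter> {..<Suc k}) = sum f (T \<inter> {..<k}) + of_bool (k \<in> T) * f k"
  for f :: "nat \<Rightarrow> nat"
  by (simp add: Int_lessThan_Suc)

lemma card_Int_Suc: "card (T \<inter> {..<Suc k}) = card (T \<inter> {..<k}) + of_bool (k \<in> T)"
  by (simp add: Int_lessThan_Suc)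

lemma wp_Sum_tree:
  assumes "data s" "indicates (s ''T'') T" "T \<subseteq> {..<n}"
  shows "wp Sum_tree (\<lambda>s'. s' ''tw'' 0 = sum w T \<and> s' ''tp'' 0 = sum p T) s"
  unfolding Sum_tree_def
proof (intro wp_Seq_Assign, goal_cases)
  case 3
  show ?case
  proof (rule wp_For[where n = n and I = "\<lambda>k s'. s' ''tw'' 0 = sum w (T \<inter> {..<k}) \<and> s' ''tp'' 0 = sum p (T \<inter> {..<k})"], goal_cases)
    case (8 k s')
    then have "s' ''T'' k = of_bool (k \<in> T)" "s' ''w'' k = w k" "s' ''p'' k = p k"
      using assms by (auto simp: agrees_def indicates_def)
    then show ?case using 8(1,2,5) sum_bound_p[of "Suc k" T] sum_bound_w[of "Suc k" T]
      by (intro wp_Seq_Assign wp_Assign) (auto simp: sum_Int_Suc)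
  qed (use assms n_le in \<open>auto simp: Int_absorb2\<close>)
qed auto

lemma wp_Sum_subtree:
  assumes "data s" "indicates (s ''T'') T" "T \<subseteq> {..<n}" "s ''v'' 0 = v" "v < n"
  shows "wp Sum_subtree (\<lambda>s'. s' ''x'' 0 = sum w (T \<inter> desc v) \<and> s' ''y'' 0 = sum p (T \<inter> desc v) \<and>
    s' ''z'' 0 = card (T \<inter> desc v)) s"
  unfolding Sum_subtree_def
proof (intro wp_Seq_Assign, goal_cases)
  case 4
  define X Y Z where "X k = sum w (T \<inter> desc v \<inter> {..<k})" and "Y k = sum p (T \<inter> desc v \<inter> {..<k})"
    and "Z k = card (T \<inter> desc v \<inter> {..<k})" for k
  have Suc: "X (Suc k) = X k + of_bool (k \<in> T) * of_bool (k \<in> desc v) * w k"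
    "Y (Suc k) = Y k + of_bool (k \<in> T) * of_bool (k \<in> desc v) * p k"
    "Z (Suc k) = Z k + of_bool (k \<in> T) * of_bool (k \<in> desc v)" for k
    unfolding X_def Y_def Z_def by (simp_all only: sum_Int_Suc card_Int_Suc Int_iff of_bool_conj)
  have bound: "X k < 2 ^ \<kappa>" "Y k < 2 ^ \<kappa>" "Z k < 2 ^ \<kappa>" if "k \<le> n" for k
    using that by (simp_all add: X_def Y_def Z_def)
  have zero: "X 0 = 0" "Y 0 = 0" "Z 0 = 0" by (simp_all add: X_def Y_def Z_def)
  have "T \<inter> desc v \<inter> {..<n} = T \<inter> desc v" using assms(3) by blast
  then have final: "X n = sum w (T \<inter> desc v)" "Y n = sum p (T \<inter> desc v)" "Z n = card (T \<inter> desc v)"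
    by (simp_all add: X_def Y_def Z_def)
  show ?case
  proof (rule wp_For[where n = n and I = "\<lambda>k s'. s' ''x'' 0 = X k \<and> s' ''y'' 0 = Y k \<and> s' ''z'' 0 = Z k"], goal_cases)
    case (8 k s')
    then have "s' ''T'' k = of_bool (k \<in> T)" "s' ''w'' k = w k" "s' ''p'' k = p k"
      "s' ''v'' 0 = v" "s' ''n'' 0 = n" "s' ''r'' (v * n + k) = of_bool (k \<in> desc v)"
      using assms by (auto simp: agrees_def indicates_def closure_matrix_def)
    then show ?case using 8(1,2,5) bound[of "Suc k"]
      by (intro wp_Seq_Assign wp_Assign) (simp_all add: Suc)
  qed (use assms n_le zero final in auto)
qed auto

lemma wp_Find_violating:
  assumes "data s" "indicates (s ''T'') T" "T \<subseteq> {..<n}" "s ''tw'' 0 = sum w T" "s ''tp'' 0 = sum p T"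
  shows "wp Find_violating (\<lambda>s'. s' ''b'' 0 = n \<and> (\<forall>v\<in>T. \<not> violating T v) \<or>
     s' ''b'' 0 < n \<and> s' ''b'' 0 \<in> T \<and> violating T (s' ''b'' 0) \<and>
     (\<forall>u\<in>T. violating T u \<longrightarrow> card (T \<inter> desc (s' ''b'' 0)) \<le> card (T \<inter> desc u))) s"
  unfolding Find_violating_def
proof (intro wp_Seq_Assign, goal_cases)
  case 3
  \<comment> \<open>Until something is found \<open>''c''\<close> keeps its initial value, which
    every subtree size beats; so a job rejected in this phase is known not to be violating.\<close>
  define I where "I k s' \<longleftrightarrow>
     s' ''b'' 0 = n \<and> s' ''c'' 0 = n + 1 \<and> (\<forall>v\<in>T \<inter> {..<k}. \<not> violating T v) \<or>
     s' ''b'' 0 < n \<and> s' ''b'' 0 \<in> T \<and> violating T (s' ''b'' 0) \<and> s' ''c'' 0 = card (T \<inter> desc (s' ''b'' 0)) \<and>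
     (\<forall>u\<in>T \<inter> {..<k}. violating T u \<longrightarrow> s' ''c'' 0 \<le> card (T \<inter> desc u))" for k and s' :: memory
  have card: "card (T \<inter> desc v) < n + 1" for v
  proof -
    have "T \<inter> desc v \<subseteq> {..<n}" using assms(3) by blast
    then show ?thesis using card_mono[of "{..<n}" "T \<inter> desc v"] by simp
  qed
  show ?case
  proof (rule wp_For[where n = n and I = I], goal_cases)
    case (8 k s')
    have s': "data s'" "indicates (s' ''T'') T" "s' ''tw'' 0 = sum w T" "s' ''tp'' 0 = sum p T"
      using 8 assms by auto
    then have Tk: "s' ''T'' k = of_bool (k \<in> T)" using 8 by (simp add: indicates_def)
    show ?case
    proof (rule wp_If)
      assume "bval (Positive (At ''T'' ''v'')) s'"
      then have kT: "k \<in> T" using Tk 8 by (simp split: if_splits)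
      show "wp (Seq Sum_subtree
         (If (And (Less (Times (Var ''x'') (Var ''tp'')) (Times (Var ''tw'') (Var ''y''))) (Less (Var ''z'') (Var ''c'')))
           (Seq (Set ''c'' (Var ''z'')) (Set ''b'' (Var ''v''))) Skip)) (I (Suc k)) s'"
      proof (rule wp_Seq[OF wp_Sum_subtree[OF s'(1,2) assms(3) 8(2,1)]], goal_cases)
        case (1 s'')
        then have *: "s'' ''tw'' 0 = sum w T" "s'' ''tp'' 0 = sum p T" "s'' ''v'' 0 = k"
          "s'' ''b'' 0 = s' ''b'' 0" "s'' ''c'' 0 = s' ''c'' 0"
          using s' 8 by auto
        define cond where "cond \<longleftrightarrow> violating T k \<and> card (T \<inter> desc k) < s' ''c'' 0"
        have cond: "bval (And (Less (Times (Var ''x'') (Var ''tp'')) (Times (Var ''tw'') (Var ''y'')))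
            (Less (Var ''z'') (Var ''c''))) s'' \<longleftrightarrow> cond"
          using 1(3) * by (simp add: cond_def violating_def)
        have lessThan_Suc: "T \<inter> {..<Suc k} = insert k (T \<inter> {..<k})"
          using kT by auto
        show ?case
        proof (rule wp_If)
          assume "bval (And (Less (Times (Var ''x'') (Var ''tp'')) (Times (Var ''tw'') (Var ''y'')))
            (Less (Var ''z'') (Var ''c''))) s''"
          then have "violating T k" "card (T \<inter> desc k) < s' ''c'' 0" using cond by (simp_all add: cond_def)
          then have "\<forall>u\<in>insert k (T \<inter> {..<k}). violating T u \<longrightarrow> card (T \<inter> desc k) \<le> card (T \<inter> desc u)"
            using 8(5) unfolding I_def by fastforce
          then have "I (Suc k) (s''(''c'' := (s'' ''c'')(0 := card (T \<inter> desc k)), ''b'' := (s'' ''b'')(0 := k)))"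
            unfolding I_def lessThan_Suc using \<open>violating T k\<close> kT 8(1) by simp
          then show "wp (Seq (Set ''c'' (Var ''z'')) (Set ''b'' (Var ''v''))) (I (Suc k)) s''"
            using 1 *(3) card[of k] n_bound 8(1) by (intro wp_Seq_Assign wp_Assign) simp_all
        next
          assume "\<not> bval (And (Less (Times (Var ''x'') (Var ''tp'')) (Times (Var ''tw'') (Var ''y'')))
            (Less (Var ''z'') (Var ''c''))) s''"
          then have nv: "violating T k \<longrightarrow> s' ''c'' 0 \<le> card (T \<inter> desc k)" using cond by (auto simp: cond_def)
          have "I (Suc k) s''"
          proof (cases "s' ''b'' 0 = n \<and> s' ''c'' 0 = n + 1 \<and> (\<forall>v\<in>T \<inter> {..<k}. \<not> violating T v)")
            case True
            then have "\<not> violating T k" using nv card[of k] by simp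
            then show ?thesis using True unfolding I_def lessThan_Suc *(4,5) by simp
          next
            case False
            then have found: "s' ''b'' 0 < n \<and> s' ''b'' 0 \<in> T \<and> violating T (s' ''b'' 0) \<and>
              s' ''c'' 0 = card (T \<inter> desc (s' ''b'' 0)) \<and>
              (\<forall>u\<in>T \<inter> {..<k}. violating T u \<longrightarrow> s' ''c'' 0 \<le> card (T \<inter> desc u))"
              using 8(5) unfolding I_def by satx
            then have "\<forall>u\<in>T \<inter> {..<k}. violating T u \<longrightarrow> s' ''c'' 0 \<le> card (T \<inter> desc u)" by satx
            then have "\<forall>u\<in>insert k (T \<inter> {..<k}). violating T u \<longrightarrow> s' ''c'' 0 \<le> card (T \<inter> desc u)"
              using nv by blast
            then have "s' ''b'' 0 < n \<and> s' ''b'' 0 \<in> T \<and> violating T (s' ''b'' 0) \<and>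
              s' ''c'' 0 = card (T \<inter> desc (s' ''b'' 0)) \<and>
              (\<forall>u\<in>insert k (T \<inter> {..<k}). violating T u \<longrightarrow> s' ''c'' 0 \<le> card (T \<inter> desc u))"
              using found by satx
            then show ?thesis unfolding I_def lessThan_Suc *(4,5) by (rule disjI2)
          qed
          then show "wp Skip (I (Suc k)) s''" by (intro wp_Skip)
        qed
      qed
    next
      assume "\<not> bval (Positive (At ''T'' ''v'')) s'"
      then have "k \<notin> T" using Tk 8 by simp
      then have "T \<inter> {..<Suc k} = T \<inter> {..<k}" by (auto simp: less_Suc_eq)
      then have "I (Suc k) s'" using 8(5) unfolding I_def by simp
      then show "wp Skip (I (Suc k)) s'" by (intro wp_Skip)
    qed
  next
    case (9 s')
    have "T \<inter> {..<n} = T" using assms(3) by blast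
    then show ?case using 9(2) unfolding I_def by (elim disjE conjE) simp_all
  qed (use assms n_le in \<open>simp_all add: I_def\<close>)
qed (use assms n_bound in simp_all)

lemma wp_Prune_round:
  assumes "data s" "indicates (s ''T'') T" "T \<subseteq> {..<n}" "R \<subseteq> {..<n}" "pruned R r T" "r \<in> T"
  shows "wp Prune_round (\<lambda>s'. \<exists>T'\<subseteq>T. indicates (s' ''T'') T' \<and> pruned R r T' \<and> r \<in> T' \<and>
     (if \<forall>v\<in>T. \<not> violating T v then T' = T else card T' < card T)) s"
  unfolding Prune_round_def
proof (rule wp_Seq[OF wp_Sum_tree[OF assms(1-3)]], goal_cases)
  case (1 s1)
  have finT: "finite T" using assms(3) finite_subset by blast
  from 1 have s1: "data s1" "indicates (s1 ''T'') T" "s1 ''tw'' 0 = sum w T" "s1 ''tp'' 0 = sum p T"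
    using assms by auto
  show ?case
  proof (rule wp_Seq[OF wp_Find_violating[OF s1(1,2) assms(3) s1(3,4)]], goal_cases)
    case (1 s2)
    have s2: "data s2" "indicates (s2 ''T'') T" using s1 1 by auto
    show ?case
    proof (rule wp_If)
      assume "\<not> bval (Less (Var ''b'') Num_of_jobs) s2"
      then have "\<forall>v\<in>T. \<not> violating T v" using 1 s2 by auto
      then show "wp Skip (\<lambda>s'. \<exists>T'\<subseteq>T. indicates (s' ''T'') T' \<and> pruned R r T' \<and> r \<in> T' \<and>
          (if \<forall>v\<in>T. \<not> violating T v then T' = T else card T' < card T)) s2"
        using s2 assms by (intro wp_Skip exI[of _ T]) auto
    next
      assume "bval (Less (Var ''b'') Num_of_jobs) s2"
      then obtain b where b: "s2 ''b'' 0 = b" "b < n" "b \<in> T" "violating T b"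
        "\<And>u. u \<in> T \<Longrightarrow> violating T u \<Longrightarrow> card (T \<inter> desc b) \<le> card (T \<inter> desc u)"
        using 1 s2 by auto
      have "closed R r T" using assms(5) by (simp add: pruned_def)
      \<comment> \<open>The root is never cut: its subtree is all of \<open>T\<close>, which is not
        sparser than itself.\<close>
      have "r \<notin> desc b"
      proof
        assume "r \<in> desc b"
        moreover have "b \<in> desc r" using \<open>closed R r T\<close> b(3) by (auto simp: closed_def)
        ultimately have "b = r" by (rule desc_antisym)
        moreover have "T \<inter> desc r = T" using \<open>closed R r T\<close> by (auto simp: closed_def)
        ultimately show False using b(4) by (simp add: violating_def)
      qed
      moreover have "card (T - desc b) < card T"
        using b(3) finT desc_refl[of b] by (intro psubset_card_mono) blast+
      moreover have "pruned R r (T - desc b)" using assms(4,5) b by (intro pruned_step)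
      ultimately have post: "T - desc b \<subseteq> T \<and> pruned R r (T - desc b) \<and> r \<in> T - desc b \<and>
        (if \<forall>v\<in>T. \<not> violating T v then T - desc b = T else card (T - desc b) < card T)"
        using assms(6) b(3,4) by auto
      show "wp (For ''u'' (Assign ''T'' (Var ''u'') (Minus (At ''T'' ''u'') (Reach ''b'' ''u''))))
         (\<lambda>s'. \<exists>T'\<subseteq>T. indicates (s' ''T'') T' \<and> pruned R r T' \<and> r \<in> T' \<and>
          (if \<forall>v\<in>T. \<not> violating T v then T' = T else card T' < card T)) s2"
      proof (rule wp_For[where n = n and I = "\<lambda>k s'. \<forall>i<n. s' ''T'' i = of_bool (i \<in> T \<and> (i < k \<longrightarrow> i \<notin> desc b))"], goal_cases)
        case (8 k s')
        then have "s' ''b'' 0 = b" "s' ''n'' 0 = n" "s' ''r'' (b * n + k) = of_bool (k \<in> desc b)"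
          using s2 b by (auto simp: closure_matrix_def)
        then show ?case using 8(1,2,5) by (intro wp_Assign) (auto simp: less_Suc_eq)
      next
        case (9 s')
        then have "indicates (s' ''T'') (T - desc b)" by (auto simp: indicates_def)
        then show ?case using post by blast
      qed (use s2 n_le in \<open>auto simp: indicates_def\<close>)
    qed
  qed
qed

text \<open>Every round that cuts shrinks \<open>T\<close>, but the root stays, so after
  \<open>n\<close> rounds nothing is left to cut; surplus rounds change nothing.\<close>

lemma wp_Prune:
  assumes "data s" "indicates (s ''T'') T" "T \<subseteq> {..<n}" "R \<subseteq> {..<n}" "pruned R r T" "r \<in> T"
  shows "wp (For ''m'' Prune_round) (\<lambda>s'. \<exists>T'\<subseteq>{..<n}. indicates (s' ''T'') T' \<and> pruned R r T' \<and> r \<in> T' \<and>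
     (\<forall>v\<in>T'. \<not> violating T' v)) s"
proof (rule wp_For[where n = n and I = "\<lambda>k s'. \<exists>T'\<subseteq>{..<n}. indicates (s' ''T'') T' \<and> pruned R r T' \<and> r \<in> T' \<and>
     ((\<forall>v\<in>T'. \<not> violating T' v) \<or> card T' + k \<le> n)"], goal_cases)
  case 7
  show ?case using assms card_mono[of "{..<n}" T] by (intro exI[of _ T]) auto
next
  case (8 k s')
  then obtain T' where T': "T' \<subseteq> {..<n}" "indicates (s' ''T'') T'" "pruned R r T'" "r \<in> T'"
    "(\<forall>v\<in>T'. \<not> violating T' v) \<or> card T' + k \<le> n" by blast
  have s': "data s'" using 8 assms by auto
  show ?case
  proof (rule wp_conseq[OF wp_Prune_round[OF s' T'(2,1) assms(4) T'(3,4)]], goal_cases)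
    case (1 s'')
    then obtain T'' where T'': "T''\<subseteq>T'" "indicates (s'' ''T'') T''" "pruned R r T''" "r \<in> T''"
     "if \<forall>v\<in>T'. \<not> violating T' v then T'' = T' else card T'' < card T'" by blast
    then have "(\<forall>v\<in>T''. \<not> violating T'' v) \<or> card T'' + Suc k \<le> n"
      using T'(5) by (cases "\<forall>v\<in>T'. \<not> violating T' v") auto
    then show ?case using T'(1) T''(1-4) by blast
  qed
next
  case (9 s')
  then obtain T' where T': "T' \<subseteq> {..<n}" "indicates (s' ''T'') T'" "pruned R r T'" "r \<in> T'"
    "(\<forall>v\<in>T'. \<not> violating T' v) \<or> card T' + n \<le> n" by blast
  have "finite T'" using T'(1) by (rule finite_subset) simp
  then have "card T' \<noteq> 0" using T'(4) by auto
  then show ?case using T' by auto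
qed (use assms n_le in auto)

end

context or_program
begin

lemma wp_Find_block:
  assumes "data s" "indicates (s ''R'') R" "R \<subseteq> {..<n}" "R \<noteq> {}"
    "agrees (s ''a'') (\<lambda>i. of_bool (available R i))" "s ''j'' 0 = n"
  shows "wp Find_block (\<lambda>s'. \<exists>U. indicates (s' ''B'') U \<and> greedy R U \<and> s' ''j'' 0 \<in> U \<and>
    available R (s' ''j'' 0)) s"
  unfolding Find_block_def
proof -
  define I where "I k s' \<longleftrightarrow>
      s' ''j'' 0 = n \<and> {r \<in> R. available R r} \<inter> {..<k} = {} \<or>
      s' ''j'' 0 < n \<and> (\<exists>U. indicates (s' ''B'') U \<and> s' ''j'' 0 \<in> U \<and> available R (s' ''j'' 0) \<and>
        best_tree R ({r \<in> R. available R r} \<inter> {..<k}) U \<and>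
        s' ''bw'' 0 = sum w U \<and> s' ''bp'' 0 = sum p U)" for k and s' :: memory
  show "wp (For ''q'' (If (Positive (Times (At ''a'' ''q'') (At ''R'' ''q'')))
     (Seq (For ''v'' (Assign ''T'' (Var ''v'') (Times (Reach ''q'' ''v'') (At ''R'' ''v''))))
     (Seq (For ''m'' Prune_round)
     (Seq Sum_tree
       (If (Not (And (Less (Var ''j'') Num_of_jobs)
            (Not (Less (Times (Var ''bw'') (Var ''tp'')) (Times (Var ''tw'') (Var ''bp''))))))
         (Seq (Set ''j'' (Var ''q'')) (Seq (Set ''bw'' (Var ''tw'')) (Seq (Set ''bp'' (Var ''tp''))
           (For ''v'' (Assign ''B'' (Var ''v'') (At ''T'' ''v''))))))
         Skip))))
     Skip)) (\<lambda>s'. \<exists>U. indicates (s' ''B'') U \<and> greedy R U \<and> s' ''j'' 0 \<in> U \<and>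
    available R (s' ''j'' 0)) s"
  proof (rule wp_For[where n = n and I = I], goal_cases)
    case (6 k s' f)
    then show ?case by (simp add: I_def)
  next
    case 7
    then show ?case using assms by (simp add: I_def)
  next
    case (8 k s1)
    have s1: "data s1" "indicates (s1 ''R'') R" "agrees (s1 ''a'') (\<lambda>i. of_bool (available R i))"
      using 8(3) assms by simp_all
    have pos: "bval (Positive (Times (At ''a'' ''q'') (At ''R'' ''q''))) s1 \<longleftrightarrow> k \<in> R \<and> available R k"
      using s1 8(1,2) by (simp add: indicates_def agrees_def conj_commute)
    show ?case
    proof (rule wp_If)
      assume "\<not> bval (Positive (Times (At ''a'' ''q'') (At ''R'' ''q''))) s1"
      then have "{r \<in> R. available R r} \<inter> {..<Suc k} = {r \<in> R. available R r} \<inter> {..<k}"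
        using pos by (auto simp: less_Suc_eq)
      then show "wp Skip (I (Suc k)) s1" using 8(5) by (intro wp_Skip) (simp add: I_def)
    next
      assume "bval (Positive (Times (At ''a'' ''q'') (At ''R'' ''q''))) s1"
      then have k: "k \<in> R" "available R k" using pos by auto
      have K: "{r \<in> R. available R r} \<inter> {..<Suc k} = insert k ({r \<in> R. available R r} \<inter> {..<k})"
        using k by (auto simp: less_Suc_eq)
      have tree: "wp (For ''v'' (Assign ''T'' (Var ''v'') (Times (Reach ''q'' ''v'') (At ''R'' ''v''))))
        (\<lambda>s'. indicates (s' ''T'') (R \<inter> desc k)) s1"
      proof (rule wp_For[where n = n and I = "\<lambda>m s'. \<forall>i<m. s' ''T'' i = of_bool (i \<in> R \<inter> desc k)"], goal_cases)
        case (8 m s2)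
        then have "s2 ''q'' 0 = k" "s2 ''n'' 0 = n" "s2 ''r'' (k * n + m) = of_bool (m \<in> desc k)"
          "s2 ''R'' m = of_bool (m \<in> R)"
          using s1 \<open>s1 ''q'' 0 = k\<close> \<open>k < n\<close> by (simp_all add: closure_matrix_def indicates_def)
        then show ?case using 8(1,2,5) by (intro wp_Assign) (auto simp: less_Suc_eq)
      qed (use s1 n_le in \<open>auto simp: indicates_def\<close>)
      show "wp (Seq (For ''v'' (Assign ''T'' (Var ''v'') (Times (Reach ''q'' ''v'') (At ''R'' ''v''))))
        (Seq (For ''m'' Prune_round)
        (Seq Sum_tree
         (If (Not (And (Less (Var ''j'') Num_of_jobs)
            (Not (Less (Times (Var ''bw'') (Var ''tp'')) (Times (Var ''tw'') (Var ''bp''))))))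
         (Seq (Set ''j'' (Var ''q'')) (Seq (Set ''bw'' (Var ''tw'')) (Seq (Set ''bp'' (Var ''tp''))
           (For ''v'' (Assign ''B'' (Var ''v'') (At ''T'' ''v''))))))
         Skip)))) (I (Suc k)) s1"
      proof (rule wp_Seq[OF tree], goal_cases)
        case (1 s2)
        then have s2: "data s2" "s2 ''q'' 0 = k" using s1 8(2) by simp_all
        have I2: "I k s2" using 8(5) 1(1) by (simp add: I_def)
        have "R \<inter> desc k \<subseteq> {..<n}" "k \<in> R \<inter> desc k" using assms(3) k by auto
        note prune = wp_Prune[OF s2(1) 1(3) this(1) assms(3) pruned_full this(2)]
        show ?case
        proof (rule wp_Seq[OF prune], goal_cases)
          case (1 s3)
          then have s3: "data s3" "s3 ''q'' 0 = k" using s2 by simp_all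
          obtain T where T: "T\<subseteq>{..<n}" "indicates (s3 ''T'') T" "pruned R k T" "k \<in> T"
            "\<And>v. v \<in> T \<Longrightarrow> \<not> violating T v" using 1(3) by blast
          have I3: "I k s3" using I2 1(1) by (simp add: I_def)
          show ?case
          proof (rule wp_Seq[OF wp_Sum_tree[OF s3(1) T(2,1)]], goal_cases)
            case (1 s4)
            then have s4: "data s4" "s4 ''q'' 0 = k" "indicates (s4 ''T'') T" using s3 T by simp_all
            have I4: "I k s4" using I3 1(1) by (simp add: I_def)
            have first: "best_tree R {k} T"
              using best_tree_first[OF assms(3) T(3,5) _ k(2)] T(4) by blast
            show ?case
            proof (rule wp_If)
              assume cond: "bval (Not (And (Less (Var ''j'') Num_of_jobs)
                (Not (Less (Times (Var ''bw'') (Var ''tp'')) (Times (Var ''tw'') (Var ''bp'')))))) s4"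
              have best: "best_tree R ({r \<in> R. available R r} \<inter> {..<Suc k}) T"
              proof (cases "{r \<in> R. available R r} \<inter> {..<k} = {}")
                case True
                then show ?thesis unfolding K by (simp only: first)
              next
                case False
                then obtain U where U: "s4 ''j'' 0 < n" "best_tree R ({r \<in> R. available R r} \<inter> {..<k}) U"
                  "s4 ''bw'' 0 = sum w U" "s4 ''bp'' 0 = sum p U"
                  using I4 unfolding I_def by blast
                then show ?thesis unfolding K using cond 1(3) s4(1)
                  by (intro best_tree_replace[OF U(2) first]) simp
              qed
              show "wp (Seq (Set ''j'' (Var ''q'')) (Seq (Set ''bw'' (Var ''tw'')) (Seq (Set ''bp'' (Var ''tp''))
                (For ''v'' (Assign ''B'' (Var ''v'') (At ''T'' ''v'')))))) (I (Suc k)) s4"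
              proof (rule wp_bounded, intro wp_Seq_Assign, goal_cases)
                case 4
                show ?case
                proof (rule wp_For[where n = n and I = "\<lambda>m s'. (\<forall>i<m. s' ''B'' i = of_bool (i \<in> T)) \<and>
                    s' ''j'' 0 = k \<and> s' ''bw'' 0 = sum w T \<and> s' ''bp'' 0 = sum p T"], goal_cases)
                  case (8 m s5)
                  then have "s5 ''T'' m = of_bool (m \<in> T)" using s4(3) by (simp add: indicates_def)
                  then show ?case using 8(1,2,5) by (intro wp_Assign) (auto simp: less_Suc_eq)
                next
                  case (9 s5)
                  then have "indicates (s5 ''B'') T" by (simp add: indicates_def)
                  then show ?case using 9 best T(4) k(2) \<open>k < n\<close> unfolding I_def by auto
                qed (use s4 1(3) n_le in auto)
              qed simp_all
            next
              assume cond: "\<not> bval (Not (And (Less (Var ''j'') Num_of_jobs)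
                (Not (Less (Times (Var ''bw'') (Var ''tp'')) (Times (Var ''tw'') (Var ''bp'')))))) s4"
              then have "s4 ''j'' 0 < n" using s4(1) by simp
              then obtain U where U: "indicates (s4 ''B'') U" "s4 ''j'' 0 \<in> U" "available R (s4 ''j'' 0)"
                "best_tree R ({r \<in> R. available R r} \<inter> {..<k}) U"
                "s4 ''bw'' 0 = sum w U" "s4 ''bp'' 0 = sum p U"
                using I4 unfolding I_def by auto
              have "best_tree R ({r \<in> R. available R r} \<inter> {..<Suc k}) U"
                unfolding K using cond 1(3) s4(1) U(5,6)
                by (intro best_tree_keep[OF assms(3) U(4) T(3,5)]) simp_all
              then show "wp Skip (I (Suc k)) s4"
                using U \<open>s4 ''j'' 0 < n\<close> by (intro wp_Skip) (auto simp: I_def)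
            qed
          qed
        qed
      qed
    qed
  next
    case (9 s')
    \<comment> \<open>The case that no root was found is impossible: \<open>R\<close> is startable
      and nonempty, so it has an available job.\<close>
    have "{r \<in> R. available R r} \<noteq> {}"
      using startable_ex_available[OF assms(3) startable_all assms(4)] by blast
    moreover have "{r \<in> R. available R r} \<inter> {..<n} = {r \<in> R. available R r}" using assms(3) by blast
    ultimately show ?case using 9 best_tree_greedy[OF assms(3)] unfolding I_def by auto
  qed (use assms n_le in auto)
qed

lemma wp_Pick_job:
  assumes "data s" "indicates (s ''B'') B" "B \<subseteq> {..<n}" "agrees (s ''a'') (\<lambda>i. of_bool (available R i))"
  shows "wp Pick_job (\<lambda>s'. s' ''j'' 0 = n \<and> (\<forall>i\<in>B. \<not> available R i) \<or>
    s' ''j'' 0 < n \<and> s' ''j'' 0 \<in> B \<and> available R (s' ''j'' 0)) s"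
  unfolding Pick_job_def
proof (intro wp_Seq_Assign, goal_cases)
  case 1
  then show ?case using assms n_bound by simp
next
  case 2
  show ?case
  proof (rule wp_For[where n = n and I = "\<lambda>k s'. s' ''j'' 0 = n \<and> (\<forall>i\<in>B. i < k \<longrightarrow> \<not> available R i) \<or>
      s' ''j'' 0 < n \<and> s' ''j'' 0 \<in> B \<and> available R (s' ''j'' 0)"], goal_cases)
    case (8 k s')
    then have "s' ''B'' k = of_bool (k \<in> B)" "s' ''a'' k = of_bool (available R k)"
      using assms by (simp_all add: indicates_def agrees_def)
    then have pos: "bval (Positive (Times (At ''B'' ''i'') (At ''a'' ''i''))) s' \<longleftrightarrow> k \<in> B \<and> available R k"
      using 8(2) by simp
    show ?case
    proof (rule wp_If)
      assume "bval (Positive (Times (At ''B'' ''i'') (At ''a'' ''i''))) s'"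
      then show "wp (Set ''j'' (Var ''i'')) (\<lambda>s'. s' ''j'' 0 = n \<and> (\<forall>i\<in>B. i < Suc k \<longrightarrow> \<not> available R i) \<or>
        s' ''j'' 0 < n \<and> s' ''j'' 0 \<in> B \<and> available R (s' ''j'' 0)) s'"
        using pos 8(1,2) n_bound by (intro wp_Assign) simp_all
    next
      assume "\<not> bval (Positive (Times (At ''B'' ''i'') (At ''a'' ''i''))) s'"
      then show "wp Skip (\<lambda>s'. s' ''j'' 0 = n \<and> (\<forall>i\<in>B. i < Suc k \<longrightarrow> \<not> available R i) \<or>
        s' ''j'' 0 < n \<and> s' ''j'' 0 \<in> B \<and> available R (s' ''j'' 0)) s'"
        using pos 8(5) by (intro wp_Skip) (auto simp: less_Suc_eq)
    qed
  qed (use assms n_le in auto)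
qed

definition output_agrees :: "(nat \<Rightarrow> nat) \<Rightarrow> nat set \<Rightarrow> nat \<Rightarrow> (nat \<Rightarrow> nat) \<Rightarrow> bool" where
  "output_agrees f R P S \<longleftrightarrow> (\<forall>j<n. j \<notin> R \<longrightarrow> f (1 + 2 * j) = S j \<and> f (2 + 2 * j) = P)"

definition represents :: "memory \<Rightarrow> nat \<Rightarrow> nat set \<Rightarrow> nat set \<Rightarrow> (nat \<Rightarrow> nat) \<Rightarrow> bool" where
  "represents s P R B S \<longleftrightarrow> data s \<and> adjacency_matrix (s ''in'') \<and> s ''P'' 0 = P \<and>
     indicates (s ''R'') R \<and> indicates (s ''B'') B \<and>
     agrees (s ''a'') (\<lambda>i. of_bool (available R i)) \<and> output_agrees (s ''out'') R P S \<and>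
     greedy_state R B (s ''t'' 0) S"

text \<open>Availability only grows as jobs complete, so the program just sets bits of
  \<open>''a''\<close>.\<close>

lemma available_Diff: "available (R - {j}) i \<longleftrightarrow> available R i \<or> (j, i) \<in> E"
  unfolding available_def by blast

lemma wp_Run_job:
  assumes "represents s P R B S" "s ''j'' 0 = j" "j \<in> B" "available R j"
  shows "wp Run_job (\<lambda>s'. represents s' P (R - {j}) (B - {j}) (S(j := s ''t'' 0))) s"
proof -
  have rep: "data s" "adjacency_matrix (s ''in'')" "s ''P'' 0 = P" "indicates (s ''R'') R" "indicates (s ''B'') B"
    "agrees (s ''a'') (\<lambda>i. of_bool (available R i))" "output_agrees (s ''out'') R P S"
    "greedy_state R B (s ''t'' 0) S"
    using assms(1) by (auto simp: represents_def)
  have R: "R \<subseteq> {..<n}" "B \<subseteq> R" using rep(8) by (auto simp: greedy_state_def startable_def)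
  have j: "j < n" using assms(3) R by auto
  have pj: "s ''p'' j = p j" using rep(1) j by (simp add: agrees_def)
  have state: "greedy_state (R - {j}) (B - {j}) (s ''t'' 0 + p j) (S(j := s ''t'' 0))"
    using greedy_state_run[OF rep(8) assms(3,4)] .
  then have t: "s ''t'' 0 + p j = sum p ({..<n} - (R - {j}))" by (simp add: greedy_state_def)
  have "sum p ({..<n} - (R - {j})) \<le> sum p {..<n}" by (intro sum_mono2) auto
  then have bound: "s ''t'' 0 + p j < 2 ^ \<kappa>" using p_bound t by simp
  have out: "output_agrees ((s ''out'')(1 + 2 * j := s ''t'' 0, 2 + 2 * j := P)) (R - {j}) P (S(j := s ''t'' 0))"
    using rep(7) unfolding output_agrees_def by (auto simp: less_Suc_eq)
  have P: "bounded s \<Longrightarrow> P < 2 ^ \<kappa>" using bounded_less[of s "''P''" 0] rep(3) by simp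
  show ?thesis
    unfolding Run_job_def
  proof (rule wp_bounded, intro wp_Seq_Assign, goal_cases)
    case 6
    show ?case
    proof (rule wp_For[where n = n and I = "\<lambda>k s'. \<forall>i<n. s' ''a'' i = of_bool (available R i \<or> i < k \<and> (j, i) \<in> E)"], goal_cases)
      case 1
      then show ?case using rep by simp
    next
      case 7
      then show ?case using rep(6) by (simp add: agrees_def)
    next
      case (8 k s')
      then have "s' ''in'' (2 + (4 * n + (n * j + k))) = of_bool ((j, k) \<in> E)" "s' ''n'' 0 = n" "s' ''j'' 0 = j"
        using rep(1,2) assms(2) j by (simp_all add: adjacency_matrix_def)
      then have pos: "bval (Positive (Edge ''j'' ''i'')) s' \<longleftrightarrow> (j, k) \<in> E" using 8(2) by simp
      show ?case
        using 8(1,2,5) pos by (intro wp_If wp_Assign wp_Skip) (auto simp: less_Suc_eq)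
    next
      case (9 s')
      then have "agrees (s' ''a'') (\<lambda>i. of_bool (available (R - {j}) i))"
        by (simp add: agrees_def available_Diff)
      moreover have "indicates ((s ''R'')(j := 0)) (R - {j})" "indicates ((s ''B'')(j := 0)) (B - {j})"
        using rep(4,5) by (auto simp: indicates_def)
      moreover have "s' ''out'' = (s ''out'')(1 + 2 * j := s ''t'' 0, 2 + 2 * j := P)"
        using 9(1) rep(3) assms(2) by simp
      ultimately show ?case using 9(1) rep(1,2,3) assms(2) out state pj by (simp add: represents_def)
    qed (use n_le in auto)
  qed (use rep assms(2) bound pj P in simp_all)
qed

lemma wp_Greedy:
  assumes "represents s P {..<n} {} S"
  shows "wp Greedy (\<lambda>s'. \<exists>B t S. output_agrees (s' ''out'') {} P S \<and> greedy_state {} B t S) s"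
  unfolding Greedy_def
proof (rule wp_For[where n = n and I = "\<lambda>k s'. \<exists>R B S. represents s' P R B S \<and> card R + k = n"], goal_cases)
  case (6 k s' f)
  then show ?case by (simp add: represents_def)
next
  case 7
  show ?case using assms by (intro exI[of _ "{..<n}"] exI[of _ "{}"] exI[of _ S]) simp
next
  case (8 k s1)
  then obtain R B S where "represents s1 P R B S" and cardR: "card R + k = n" by blast
  then have rep: "data s1" "adjacency_matrix (s1 ''in'')" "s1 ''P'' 0 = P" "indicates (s1 ''R'') R" "indicates (s1 ''B'') B"
    "agrees (s1 ''a'') (\<lambda>i. of_bool (available R i))" "output_agrees (s1 ''out'') R P S"
    "greedy_state R B (s1 ''t'' 0) S"
    by (simp_all add: represents_def)
  have R: "R \<subseteq> {..<n}" and B: "startable R B" using rep(8) by (simp_all add: greedy_state_def)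
  have "B \<subseteq> {..<n}" using B R by (auto simp: startable_def)
  have "R \<noteq> {}" using cardR 8(1) by auto
  show ?case
  proof (rule wp_Seq[OF wp_Pick_job[OF rep(1,5) \<open>B \<subseteq> {..<n}\<close> rep(6)]], goal_cases)
    case (1 s2)
    then have rep2: "data s2" "adjacency_matrix (s2 ''in'')" "s2 ''P'' 0 = P" "indicates (s2 ''R'') R" "indicates (s2 ''B'') B"
      "agrees (s2 ''a'') (\<lambda>i. of_bool (available R i))" "output_agrees (s2 ''out'') R P S"
      "greedy_state R B (s2 ''t'' 0) S"
      using rep by simp_all
    have pick: "wp (If (Less (Var ''j'') Num_of_jobs) Skip Find_block)
      (\<lambda>s'. \<exists>B. represents s' P R B S \<and> s' ''j'' 0 \<in> B \<and> available R (s' ''j'' 0)) s2"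
    proof (rule wp_If)
      assume "bval (Less (Var ''j'') Num_of_jobs) s2"
      then have "s2 ''j'' 0 \<in> B \<and> available R (s2 ''j'' 0)" using 1(3) rep2(1) by auto
      then show "wp Skip (\<lambda>s'. \<exists>B. represents s' P R B S \<and> s' ''j'' 0 \<in> B \<and> available R (s' ''j'' 0)) s2"
        using rep2 by (intro wp_Skip exI[of _ B]) (simp add: represents_def)
    next
      assume "\<not> bval (Less (Var ''j'') Num_of_jobs) s2"
      then have none: "s2 ''j'' 0 = n" "\<forall>i\<in>B. \<not> available R i" using 1(3) rep2(1) by auto
      then have "B = {}" using startable_ex_available[OF R B] by blast
      show "wp Find_block (\<lambda>s'. \<exists>B. represents s' P R B S \<and> s' ''j'' 0 \<in> B \<and> available R (s' ''j'' 0)) s2"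
      proof (rule wp_conseq[OF wp_Find_block[OF rep2(1,4) R \<open>R \<noteq> {}\<close> rep2(6) none(1)]], goal_cases)
        case (1 s3)
        then obtain U where U: "indicates (s3 ''B'') U" "greedy R U" "s3 ''j'' 0 \<in> U" "available R (s3 ''j'' 0)"
          by blast
        have "greedy_state R U (s2 ''t'' 0) S"
          using greedy_state_select U(2) rep2(8) \<open>B = {}\<close> by blast
        then have "represents s3 P R U S" using 1(1) U(1) rep2 by (simp add: represents_def)
        then show ?case using U(3,4) by blast
      qed
    qed
    show ?case
    proof (rule wp_Seq[OF pick], goal_cases)
      case (1 s3)
      then obtain B' where B': "represents s3 P R B' S" "s3 ''j'' 0 \<in> B'" "available R (s3 ''j'' 0)" by blast
      then have "s3 ''j'' 0 \<in> R" unfolding represents_def greedy_state_def startable_def by blast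
      moreover have "finite R" using R finite_subset by blast
      ultimately have "card (R - {s3 ''j'' 0}) + Suc k = n" using cardR by (metis add_Suc_shift card_Suc_Diff1)
      then show ?case
        by (intro wp_conseq[OF wp_Run_job[OF B'(1) refl B'(2,3)]]) blast
    qed
  qed
next
  case (9 s')
  then obtain R B S where R: "represents s' P R B S" "card R + n = n" by blast
  have "finite R" using R(1) finite_subset[of R "{..<n}"] by (simp add: represents_def greedy_state_def)
  then have "R = {}" using R(2) by simp
  then show ?case using R(1) unfolding represents_def by blast
qed (use assms n_le in \<open>simp_all add: represents_def\<close>)

end

section \<open>Initialisation and transitive closure\<close>

definition Read_input :: com where
  "Read_input = Seq (Set ''n'' (Cell ''in'' (Num 1))) (Seq (Set ''P'' (Num 1)) (Seq (Set ''W'' (Num 1))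
     (For ''i'' (Seq (Set ''P'' (Times (Var ''P'') (Cell ''in'' (Plus (Num 3) (Times (Num 4) (Var ''i''))))))
       (Set ''W'' (Times (Var ''W'') (Cell ''in'' (Plus (Num 5) (Times (Num 4) (Var ''i''))))))))))"

definition Scale :: com where
  "Scale = For ''i'' (Seq
     (Assign ''p'' (Var ''i'') (Times (Cell ''in'' (Plus (Num 2) (Times (Num 4) (Var ''i''))))
       (Div (Var ''P'') (Cell ''in'' (Plus (Num 3) (Times (Num 4) (Var ''i'')))))))
     (Assign ''w'' (Var ''i'') (Times (Cell ''in'' (Plus (Num 4) (Times (Num 4) (Var ''i''))))
       (Div (Var ''W'') (Cell ''in'' (Plus (Num 5) (Times (Num 4) (Var ''i''))))))))"

definition Init_jobs :: com where
  "Init_jobs = Seq (For ''i'' (Seq (Assign ''R'' (Var ''i'') (Num 1)) (Assign ''a'' (Var ''i'') (Num 1))))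
     (For ''i'' (For ''v'' (If (Positive (Edge ''i'' ''v'')) (Assign ''a'' (Var ''v'') (Num 0)) Skip)))"

definition Init_reach :: com where
  "Init_reach = Seq (For ''i'' (For ''v'' (Assign ''r'' (Plus (Times (Var ''i'') Num_of_jobs) (Var ''v'')) (Edge ''i'' ''v''))))
     (For ''i'' (Assign ''r'' (Plus (Times (Var ''i'') Num_of_jobs) (Var ''i'')) (Num 1)))"

definition Warshall_row :: com where
  "Warshall_row = For ''v'' (If (Positive (Times (Reach ''i'' ''k'') (Reach ''k'' ''v'')))
     (Assign ''r'' (Plus (Times (Var ''i'') Num_of_jobs) (Var ''v'')) (Num 1)) Skip)"

definition Warshall :: com where
  "Warshall = For ''k'' (For ''i'' Warshall_row)"

definition Or_schedule :: com where
  "Or_schedule = Seq Read_input (Seq Scale (Seq Init_jobs (Seq Init_reach (Seq Warshall (Seq Greedy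
     (Set ''out'' (Times (Num 2) Num_of_jobs)))))))"

lemma writes_init [simp]:
  "writes Read_input = {''n'', ''P'', ''W'', ''i''}"
  "writes Scale = {''p'', ''w'', ''i''}"
  "writes Init_jobs = {''R'', ''a'', ''i'', ''v''}"
  "writes Init_reach = {''r'', ''i'', ''v''}"
  "writes Warshall_row = {''r'', ''v''}"
  "writes Warshall = {''r'', ''i'', ''v'', ''k''}"
  "writes Greedy = {''k'', ''j'', ''i'', ''q'', ''v'', ''T'', ''m'', ''tw'', ''tp'', ''u'', ''c'', ''b'', ''x'', ''y'', ''z'', ''bw'', ''bp'', ''B'', ''out'', ''t'', ''R'', ''a''}"
  unfolding Read_input_def Scale_def Init_jobs_def Init_reach_def Warshall_row_def Warshall_def Greedy_def
  by auto

section \<open>Initial availability and Warshall's algorithm\<close>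

context or_program
begin

definition matrix :: "(nat \<Rightarrow> nat) \<Rightarrow> (nat \<Rightarrow> nat \<Rightarrow> bool) \<Rightarrow> bool" where
  "matrix f G \<longleftrightarrow> (\<forall>i<n. \<forall>j<n. f (i * n + j) = of_bool (G i j))"

lemma index_eq_iff:
  fixes i j a b :: nat
  assumes "j < n" "b < n"
  shows "i * n + j = a * n + b \<longleftrightarrow> i = a \<and> j = b"
proof
  assume "i * n + j = a * n + b"
  then have "(i * n + j) div n = (a * n + b) div n" "(i * n + j) mod n = (a * n + b) mod n" by simp_all
  then show "i = a \<and> j = b" using assms by simp
qed simp

lemma matrix_upd:
  assumes "matrix f G" "b < n" "\<And>i j. i < n \<Longrightarrow> j < n \<Longrightarrow> G' i j \<longleftrightarrow> (if i = a \<and> j = b then v else G i j)"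
  shows "matrix (f(a * n + b := of_bool v)) G'"
  using assms by (auto simp: matrix_def index_eq_iff)

lemma matrix_cong:
  assumes "matrix f G" "\<And>i j. i < n \<Longrightarrow> j < n \<Longrightarrow> G' i j = G i j"
  shows "matrix f G'"
  using assms by (simp add: matrix_def)

lemma wp_Init_jobs:
  assumes "s ''n'' 0 = n" "adjacency_matrix (s ''in'')"
  shows "wp Init_jobs (\<lambda>s'. indicates (s' ''R'') {..<n} \<and> agrees (s' ''a'') (\<lambda>i. of_bool (available {..<n} i))) s"
proof -
  have ones: "wp (For ''i'' (Seq (Assign ''R'' (Var ''i'') (Num 1)) (Assign ''a'' (Var ''i'') (Num 1))))
    (\<lambda>s'. \<forall>i<n. s' ''R'' i = 1 \<and> s' ''a'' i = 1) s"
  proof (rule wp_For[where n = n and I = "\<lambda>k s'. \<forall>i<k. s' ''R'' i = 1 \<and> s' ''a'' i = 1"], goal_cases)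
    case (8 k s')
    then show ?case by (intro wp_Seq_Assign wp_Assign) (simp_all add: less_Suc_eq)
  qed (use assms n_le in simp_all)
  show ?thesis
    unfolding Init_jobs_def
  proof (rule wp_Seq[OF ones], goal_cases)
    case (1 s1)
    then have s1: "s1 ''n'' 0 = n" "adjacency_matrix (s1 ''in'')" using assms by simp_all
    show ?case
    proof (rule wp_For[where n = n and I = "\<lambda>k s'. indicates (s' ''R'') {..<n} \<and>
        (\<forall>j<n. s' ''a'' j = of_bool (\<forall>i<k. (i, j) \<notin> E))"], goal_cases)
      case 7
      then show ?case using 1(3) by (simp add: indicates_def)
    next
      case (8 k s2)
      then have s2: "s2 ''n'' 0 = n" "adjacency_matrix (s2 ''in'')" "s2 ''i'' 0 = k" using s1 by simp_all
      show ?case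
      proof (rule wp_For[where n = n and I = "\<lambda>m s'. indicates (s' ''R'') {..<n} \<and>
        (\<forall>j<n. s' ''a'' j = of_bool ((\<forall>i<k. (i, j) \<notin> E) \<and> (j < m \<longrightarrow> (k, j) \<notin> E)))"], goal_cases)
        case 7
        then show ?case using 8(5) by simp
      next
        case (8 m s3)
        then have "s3 ''n'' 0 = n" "s3 ''i'' 0 = k" "s3 ''in'' (2 + (4 * n + (n * k + m))) = of_bool ((k, m) \<in> E)"
          using s2 \<open>k < n\<close> by (simp_all add: adjacency_matrix_def)
        then have pos: "bval (Positive (Edge ''i'' ''v'')) s3 \<longleftrightarrow> (k, m) \<in> E" using 8(2) by simp
        show ?case
        proof (rule wp_If)
          assume "bval (Positive (Edge ''i'' ''v'')) s3"
          then show "wp (Assign ''a'' (Var ''v'') (Num 0)) (\<lambda>s'. indicates (s' ''R'') {..<n} \<and>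
            (\<forall>j<n. s' ''a'' j = of_bool ((\<forall>i<k. (i, j) \<notin> E) \<and> (j < Suc m \<longrightarrow> (k, j) \<notin> E)))) s3"
            using pos 8(1,2,5) by (intro wp_Assign) (simp_all add: less_Suc_eq)
        next
          assume "\<not> bval (Positive (Edge ''i'' ''v'')) s3"
          then show "wp Skip (\<lambda>s'. indicates (s' ''R'') {..<n} \<and>
            (\<forall>j<n. s' ''a'' j = of_bool ((\<forall>i<k. (i, j) \<notin> E) \<and> (j < Suc m \<longrightarrow> (k, j) \<notin> E)))) s3"
            using pos 8(1,2,5) by (intro wp_Skip) (auto simp: less_Suc_eq)
        qed
      next
        case (9 s3)
        then show ?case by (auto simp: less_Suc_eq)
      qed (use s2 n_le in simp_all)
    next
      case (9 s')
      have "available {..<n} j \<longleftrightarrow> (\<forall>i<n. (i, j) \<notin> E)" for j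
        using E_sub unfolding available_def by blast
      then show ?case using 9(2) by (simp add: agrees_def)
    qed (use s1 n_le in simp_all)
  qed
qed

lemma wp_Init_reach:
  assumes "s ''n'' 0 = n" "adjacency_matrix (s ''in'')"
  shows "wp Init_reach (\<lambda>s'. matrix (s' ''r'') (\<lambda>i j. (i, j) \<in> E\<^sup>=)) s"
proof -
  have edges: "wp (For ''i'' (For ''v'' (Assign ''r'' (Plus (Times (Var ''i'') Num_of_jobs) (Var ''v'')) (Edge ''i'' ''v''))))
    (\<lambda>s'. matrix (s' ''r'') (\<lambda>i j. (i, j) \<in> E)) s"
  proof (rule wp_For[where n = n and I = "\<lambda>k s'. \<forall>i<k. \<forall>j<n. s' ''r'' (i * n + j) = of_bool ((i, j) \<in> E)"], goal_cases)
    case (8 k s1)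
    then have s1: "s1 ''n'' 0 = n" "adjacency_matrix (s1 ''in'')" "s1 ''i'' 0 = k" using assms by simp_all
    show ?case
    proof (rule wp_For[where n = n and I = "\<lambda>m s'. \<forall>i j. j < n \<longrightarrow> i < k \<or> i = k \<and> j < m \<longrightarrow>
        s' ''r'' (i * n + j) = of_bool ((i, j) \<in> E)"], goal_cases)
      case 7
      then show ?case using 8(5) by simp
    next
      case (8 m s2)
      then have s2: "s2 ''n'' 0 = n" "s2 ''i'' 0 = k" "s2 ''in'' (2 + (4 * n + (n * k + m))) = of_bool ((k, m) \<in> E)"
        using s1 \<open>k < n\<close> by (simp_all add: adjacency_matrix_def)
      then show ?case using 8(1,2,5)
        by (intro wp_Assign) (simp_all add: index_eq_iff less_Suc_eq)
    next
      case (9 s2)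
      then show ?case by (simp add: less_Suc_eq)
    qed (use s1 n_le in simp_all)
  next
    case (9 s1)
    then show ?case by (simp add: matrix_def)
  qed (use assms n_le in simp_all)
  show ?thesis
    unfolding Init_reach_def
  proof (rule wp_Seq[OF edges], goal_cases)
    case (1 s1)
    show ?case
    proof (rule wp_For[where n = n and I = "\<lambda>k s'. matrix (s' ''r'') (\<lambda>i j. (i, j) \<in> E \<or> i = j \<and> i < k)"], goal_cases)
      case 7
      show ?case using 1(3) by simp
    next
      case (8 k s2)
      then have n: "s2 ''n'' 0 = n" using 1(1) assms by simp
      have "matrix ((s2 ''r'')(k * n + k := of_bool True)) (\<lambda>i j. (i, j) \<in> E \<or> i = j \<and> i < Suc k)"
        using 8(1,5) by (intro matrix_upd[where G = "\<lambda>i j. (i, j) \<in> E \<or> i = j \<and> i < k"]) auto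
      then show ?case using 8(2) n by (intro wp_Assign) simp_all
    next
      case (9 s2)
      then show ?case by (auto elim!: matrix_cong)
    qed (use 1(1) assms n_le in simp_all)
  qed
qed

text \<open>The update is in place, yet the old \<open>G\<close> may be used throughout: row
  \<open>k\<close> and column \<open>k\<close> do not change in round \<open>k\<close>, as
  \<open>G i k \<or> G i k \<and> G k k\<close> is just \<open>G i k\<close>, and similarly for the
  row.\<close>

lemma wp_Warshall_row:
  assumes "s ''n'' 0 = n" "matrix (s ''r'') G" "s ''i'' 0 = i" "s ''k'' 0 = k" "i < n" "k < n"
  shows "wp Warshall_row (\<lambda>s'. matrix (s' ''r'') (\<lambda>a b. G a b \<or> a = i \<and> G i k \<and> G k b)) s"
  unfolding Warshall_row_def
proof (rule wp_For[where n = n and I = "\<lambda>m s'. matrix (s' ''r'') (\<lambda>a b. G a b \<or> a = i \<and> b < m \<and> G i k \<and> G k b)"], goal_cases)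
  case (8 m s')
  then have s': "s' ''n'' 0 = n" "s' ''i'' 0 = i" "s' ''k'' 0 = k" using assms by simp_all
  have "s' ''r'' (i * n + k) = of_bool (G i k)" "s' ''r'' (k * n + m) = of_bool (G k m)"
    using 8(1,5) assms(5,6) by (auto simp: matrix_def)
  then have pos: "bval (Positive (Times (Reach ''i'' ''k'') (Reach ''k'' ''v''))) s' \<longleftrightarrow> G i k \<and> G k m"
    using s' 8(2) by simp
  show ?case
  proof (rule wp_If)
    assume "bval (Positive (Times (Reach ''i'' ''k'') (Reach ''k'' ''v''))) s'"
    then have "matrix ((s' ''r'')(i * n + m := of_bool True)) (\<lambda>a b. G a b \<or> a = i \<and> b < Suc m \<and> G i k \<and> G k b)"
      using pos 8(1,5) by (intro matrix_upd[where G = "\<lambda>a b. G a b \<or> a = i \<and> b < m \<and> G i k \<and> G k b"]) auto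
    then show "wp (Assign ''r'' (Plus (Times (Var ''i'') Num_of_jobs) (Var ''v'')) (Num 1))
      (\<lambda>s'. matrix (s' ''r'') (\<lambda>a b. G a b \<or> a = i \<and> b < Suc m \<and> G i k \<and> G k b)) s'"
      using s' 8(2) by (intro wp_Assign) simp_all
  next
    assume "\<not> bval (Positive (Times (Reach ''i'' ''k'') (Reach ''k'' ''v''))) s'"
    then have "matrix (s' ''r'') (\<lambda>a b. G a b \<or> a = i \<and> b < Suc m \<and> G i k \<and> G k b)"
      using pos by (intro matrix_cong[OF 8(5)]) (auto simp: less_Suc_eq)
    then show "wp Skip (\<lambda>s'. matrix (s' ''r'') (\<lambda>a b. G a b \<or> a = i \<and> b < Suc m \<and> G i k \<and> G k b)) s'"
      by (intro wp_Skip)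
  qed
next
  case (9 s')
  show ?case by (rule matrix_cong[OF 9(2)]) auto
qed (use assms n_le in simp_all)

lemma wp_Warshall_round:
  assumes "s ''n'' 0 = n" "matrix (s ''r'') G" "s ''k'' 0 = k" "k < n"
  shows "wp (For ''i'' Warshall_row) (\<lambda>s'. matrix (s' ''r'') (\<lambda>a b. G a b \<or> G a k \<and> G k b)) s"
proof (rule wp_For[where n = n and I = "\<lambda>m s'. matrix (s' ''r'') (\<lambda>a b. G a b \<or> a < m \<and> G a k \<and> G k b)"], goal_cases)
  case (8 m s')
  then have s': "s' ''n'' 0 = n" "s' ''k'' 0 = k" using assms by simp_all
  show ?case
  proof (rule wp_conseq[OF wp_Warshall_row[OF s'(1) 8(5,2) s'(2) 8(1) assms(4)]], goal_cases)
    case (1 s'')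
    show ?case by (rule matrix_cong[OF 1(3)]) (auto simp: less_Suc_eq)
  qed
next
  case (9 s')
  show ?case by (rule matrix_cong[OF 9(2)]) auto
qed (use assms n_le in simp_all)

text \<open>This replaces the usual invariant on paths with inner vertices below \<open>k\<close>.
  Transitivity through single vertices is easier to propagate, and it suffices in the end: a path is
  extended by an edge whose source is below \<open>n\<close>.\<close>

definition partial_closure :: "nat \<Rightarrow> (nat \<Rightarrow> nat \<Rightarrow> bool) \<Rightarrow> bool" where
  "partial_closure k G \<longleftrightarrow> (\<forall>i j. (i, j) \<in> E\<^sup>= \<longrightarrow> G i j) \<and> (\<forall>i j. G i j \<longrightarrow> (i, j) \<in> E\<^sup>*) \<and>
     (\<forall>x<k. \<forall>i j. G i x \<longrightarrow> G x j \<longrightarrow> G i j)"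

lemma partial_closure_Suc:
  assumes "partial_closure k G"
  shows "partial_closure (Suc k) (\<lambda>a b. G a b \<or> G a k \<and> G k b)"
proof -
  have G: "\<And>i j. (i, j) \<in> E\<^sup>= \<Longrightarrow> G i j" "\<And>i j. G i j \<Longrightarrow> (i, j) \<in> E\<^sup>*"
    "\<And>x i j. x < k \<Longrightarrow> G i x \<Longrightarrow> G x j \<Longrightarrow> G i j"
    using assms unfolding partial_closure_def by blast+
  have "G i j \<or> G i k \<and> G k j"
    if "x < Suc k" "G i x \<or> G i k \<and> G k x" "G x j \<or> G x k \<and> G k j" for x i j
  proof (cases "x = k")
    case False
    then have "x < k" using that(1) by simp
    then show ?thesis using that(2,3) G(3)[of x i j] G(3)[of x i k] G(3)[of x k j] by argo
  qed (use that in blast)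
  moreover have "(i, j) \<in> E\<^sup>*" if "G i j \<or> G i k \<and> G k j" for i j
    using that G(2) rtrancl_trans[of i k E j] by blast
  ultimately show ?thesis using G(1) unfolding partial_closure_def by simp
qed

lemma partial_closure_full:
  assumes "partial_closure n G"
  shows "G i j \<longleftrightarrow> (i, j) \<in> E\<^sup>*"
proof
  assume "(i, j) \<in> E\<^sup>*"
  then show "G i j"
  proof (induction rule: rtrancl_induct)
    case base
    then show ?case using assms by (simp add: partial_closure_def)
  next
    case (step y z)
    then have "y < n" "G y z" using E_sub assms by (auto simp: partial_closure_def)
    then show ?case using step(3) assms unfolding partial_closure_def by blast
  qed
qed (use assms in \<open>simp add: partial_closure_def\<close>)

lemma wp_Warshall:
  assumes "s ''n'' 0 = n" "matrix (s ''r'') (\<lambda>i j. (i, j) \<in> E\<^sup>=)"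
  shows "wp Warshall (\<lambda>s'. closure_matrix (s' ''r'')) s"
  unfolding Warshall_def
proof (rule wp_For[where n = n and I = "\<lambda>k s'. \<exists>G. matrix (s' ''r'') G \<and> partial_closure k G"], goal_cases)
  case 7
  have "partial_closure 0 (\<lambda>i j. (i, j) \<in> E\<^sup>=)" unfolding partial_closure_def by auto
  then show ?case using assms(2) by blast
next
  case (8 k s')
  then obtain G where G: "matrix (s' ''r'') G" "partial_closure k G" by blast
  have n: "s' ''n'' 0 = n" using 8(3) assms(1) by simp
  show ?case
    using partial_closure_Suc[OF G(2)] by (intro wp_conseq[OF wp_Warshall_round[OF n G(1) 8(2,1)]]) blast
next
  case (9 s')
  then obtain G where G: "matrix (s' ''r'') G" "partial_closure n G" by blast
  then show ?case by (simp add: matrix_def closure_matrix_def desc_def partial_closure_full)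
qed (use assms n_le in simp_all)

end

section \<open>Encoded instances\<close>

text \<open>Feasibility does not depend on the unit of time, which allows passing from rational data
  to integers.\<close>

lemma feasible_scale:
  assumes "0 < (c::real)"
  shows "feasible N (\<lambda>j. p j / c) E (\<lambda>j. S j / c) \<longleftrightarrow> feasible N p E S"
  using assms by (simp add: feasible_def completion_def divide_le_cancel zero_le_divide_iff flip: add_divide_distrib)

lemma objective_scale:
  "objective N (\<lambda>j. p j / c) (\<lambda>j. w j / d) (\<lambda>j. S j / c) = objective N p w S / (c * d)" for c d :: real
  by (simp add: objective_def completion_def sum_divide_distrib mult.commute flip: add_divide_distrib)

lemma nth_concat_blocks:
  assumes "\<And>j. j < m \<Longrightarrow> length (f j) = l" "j < m" "c < l"
  shows "concat (map f [0..<m]) ! (l * j + c) = f j ! c"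
  using assms(1,2)
proof (induction m)
  case (Suc m)
  have len: "length (concat (map f [0..<m])) = l * m"
  proof -
    have "map (length \<circ> f) [0..<m] = map (\<lambda>_. l) [0..<m]" using Suc(2) by simp
    then show ?thesis by (simp add: length_concat sum_list_triv del: map_eq_conv)
  qed
  show ?case
  proof (cases "j = m")
    case True
    then show ?thesis using len by (simp add: nth_append)
  next
    case False
    then have "j < m" using Suc(3) by simp
    then have "Suc j * l \<le> m * l" by (intro mult_le_mono1) simp
    then have "l * j + c < l * m" using assms(3) by (simp add: mult.commute)
    then show ?thesis using Suc \<open>j < m\<close> len by (simp add: nth_append)
  qed
qed simp

lemma length_concat_blocks:
  assumes "\<And>j. j < m \<Longrightarrow> length (f j) = l"
  shows "length (concat (map f [0..<m])) = l * m"
  using assms by (induction m) simp_all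

lemma less_power_cost: "x < 2 ^ cost x"
proof -
  have "x < 2 ^ floorlog 2 x"
  proof (cases "x = 0")
    case False
    then show ?thesis using floorlog_bounds[of x 2] by simp
  qed (simp add: floorlog_def)
  also have "\<dots> \<le> 2 ^ cost x" by (simp add: cost_def)
  finally show ?thesis .
qed

lemma cost_le_input_size: "x \<in> set xs \<Longrightarrow> cost x \<le> input_size xs"
  unfolding input_size_def by (simp add: member_le_sum_list)

lemma length_le_input_size: "length xs \<le> input_size xs"
proof (induction xs)
  case (Cons x xs)
  then show ?case by (simp add: input_size_def cost_def)
qed simp

lemma input_size_append [simp]: "input_size (xs @ ys) = input_size xs + input_size ys"
  by (simp add: input_size_def)

lemma prod_less_power_cost:
  "(\<Prod>j<m. f j) \<le> 2 ^ (\<Sum>j<m. cost (f j))" for f :: "nat \<Rightarrow> nat"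
  using less_power_cost[THEN less_imp_le]
  by (induction m) (auto simp: power_add intro!: mult_le_mono)

lemma input_size_blocks: "input_size (concat (map f [0..<m])) = (\<Sum>j<m. input_size (f j))"
  by (induction m) (simp_all add: input_size_def)

section \<open>The integral instance behind an encoding\<close>

locale encoded_inst =
  fixes I :: or_inst
  assumes valid: "valid_inst I" and multi: "multitree (jobs I) (prec I)"
begin

definition "n = njobs I"
definition "xs = encode_inst I"
definition "pn j = nat (fst (quotient_of (ptime I j)))"
definition "pd j = nat (snd (quotient_of (ptime I j)))"
definition "wn j = nat (fst (quotient_of (weight I j)))"
definition "wd j = nat (snd (quotient_of (weight I j)))"
definition "PD = (\<Prod>j<n. pd j)"
definition "WD = (\<Prod>j<n. wd j)"
definition "p j = pn j * (PD div pd j)"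
definition "w j = wn j * (WD div wd j)"
text \<open>For input size \<open>s\<close>, a scaled time or weight is a numerator times a product
  of denominators, at most \<open>2 ^ s\<close> each; summing \<open>n < 2 ^ s\<close> of them gives
  the third \<open>s\<close>. The two spare bits provide strictness and room for
  \<open>2 * n + 1\<close>.\<close>

definition "\<kappa> = 3 * input_size xs + 2"

lemma denominators: "0 < pd j" "0 < wd j" "0 < PD" "0 < WD"
  using quotient_of_denom_pos' by (auto simp: pd_def wd_def PD_def WD_def)

lemma of_rat_quotient:
  assumes "0 \<le> q"
  shows "(of_rat q :: real) = real (nat (fst (quotient_of q))) / real (nat (snd (quotient_of q)))"
proof -
  obtain a b where q: "quotient_of q = (a, b)" by (cases "quotient_of q")
  have "0 < b" using quotient_of_denom_pos[OF q] .
  have eq: "q = of_int a / of_int b" using quotient_of_div[OF q] .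
  then have "0 \<le> a" using assms \<open>0 < b\<close> by (simp add: zero_le_divide_iff)
  then show ?thesis using eq \<open>0 < b\<close> q by (simp add: of_rat_divide)
qed

lemma ptime_real_eq: "j < n \<Longrightarrow> ptime_real I j = real (p j) / real PD"
proof -
  assume j: "j < n"
  have "0 \<le> ptime I j" using valid j by (simp add: valid_inst_def jobs_def n_def)
  then have "ptime_real I j = real (pn j) / real (pd j)"
    unfolding ptime_real_def pn_def pd_def by (rule of_rat_quotient)
  moreover have "pd j dvd PD" using j by (auto simp: PD_def intro: dvd_prodI)
  then have "real (p j) = real (pn j) * (real PD / real (pd j))"
    by (simp add: p_def real_of_nat_div)
  ultimately show ?thesis using denominators by simp
qed

lemma weight_real_eq: "j < n \<Longrightarrow> weight_real I j = real (w j) / real WD"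
proof -
  assume j: "j < n"
  have "0 \<le> weight I j" using valid j by (simp add: valid_inst_def jobs_def n_def)
  then have "weight_real I j = real (wn j) / real (wd j)"
    unfolding weight_real_def wn_def wd_def by (rule of_rat_quotient)
  moreover have "wd j dvd WD" using j by (auto simp: WD_def intro: dvd_prodI)
  then have "real (w j) = real (wn j) * (real WD / real (wd j))"
    by (simp add: w_def real_of_nat_div)
  ultimately show ?thesis using denominators by simp
qed

lemma xs_eq: "xs = n # concat (map (\<lambda>j. [pn j, pd j, wn j, wd j]) [0..<n]) @
    concat (map (\<lambda>i. map (\<lambda>j. of_bool ((i, j) \<in> prec I)) [0..<n]) [0..<n])"
  unfolding xs_def encode_inst_def encode_rat_def n_def pn_def pd_def wn_def wd_def
  by (simp add: Let_def case_prod_beta of_bool_def)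

abbreviation "input \<equiv> input_memory xs"

lemma length_xs: "length xs = 1 + 4 * n + n * n"
  unfolding xs_eq by (simp add: length_concat_blocks[where l = 4] length_concat_blocks[where l = n])

lemma input_Suc: "i < length xs \<Longrightarrow> input ''in'' (Suc i) = xs ! i"
  by (simp add: input_memory_def)

lemma input_jobs:
  assumes "j < n"
  shows "input ''in'' (2 + 4 * j) = pn j" "input ''in'' (3 + 4 * j) = pd j"
    "input ''in'' (4 + 4 * j) = wn j" "input ''in'' (5 + 4 * j) = wd j"
proof -
  have *: "input ''in'' (Suc (Suc (4 * j + c))) = [pn j, pd j, wn j, wd j] ! c" if "c < 4" for c
  proof -
    have "4 * j + c < 4 * n" using assms that by simp
    then have "input ''in'' (Suc (Suc (4 * j + c))) = concat (map (\<lambda>j. [pn j, pd j, wn j, wd j]) [0..<n]) ! (4 * j + c)"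
      using length_xs by (subst input_Suc) (simp_all add: xs_eq nth_append length_concat_blocks[where l = 4])
    then show ?thesis using assms that by (subst (asm) nth_concat_blocks[where l = 4]) simp_all
  qed
  show "input ''in'' (2 + 4 * j) = pn j" using *[of 0] by simp
  show "input ''in'' (3 + 4 * j) = pd j" using *[of 1] by (simp add: eval_nat_numeral)
  show "input ''in'' (4 + 4 * j) = wn j" using *[of 2] by (simp add: eval_nat_numeral)
  show "input ''in'' (5 + 4 * j) = wd j" using *[of 3] by (simp add: eval_nat_numeral)
qed

lemma input_matrix:
  assumes "i < n" "j < n"
  shows "input ''in'' (2 + (4 * n + (n * i + j))) = of_bool ((i, j) \<in> prec I)"
proof -
  have "Suc i * n \<le> n * n" using assms(1) by (intro mult_le_mono1) simp
  then have "n * i + j < n * n" using assms(2) by (simp add: mult.commute)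
  then have "input ''in'' (Suc (Suc (4 * n + (n * i + j)))) =
      concat (map (\<lambda>i. map (\<lambda>j. of_bool ((i, j) \<in> prec I)) [0..<n]) [0..<n]) ! (n * i + j)"
    using length_xs by (subst input_Suc) (simp_all add: xs_eq nth_append length_concat_blocks[where l = 4])
  then show ?thesis using assms by (subst (asm) nth_concat_blocks[where l = n]) simp_all
qed

lemma entry_bound: "x \<in> set xs \<Longrightarrow> x < 2 ^ input_size xs"
  using less_power_cost[of x] power_increasing[OF cost_le_input_size[of x xs], of "2::nat"] by linarith

lemma n_le: "n \<le> input_size xs"
  using length_xs length_le_input_size[of xs] by simp

lemma size_blocks: "(\<Sum>j<n. cost (pn j) + cost (pd j) + cost (wn j) + cost (wd j)) \<le> input_size xs"
proof -
  have "xs = [n] @ concat (map (\<lambda>j. [pn j, pd j, wn j, wd j]) [0..<n]) @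
      concat (map (\<lambda>i. map (\<lambda>j. of_bool ((i, j) \<in> prec I)) [0..<n]) [0..<n])"
    unfolding xs_eq by simp
  then have "input_size xs = input_size [n] + ((\<Sum>j<n. input_size [pn j, pd j, wn j, wd j]) +
      input_size (concat (map (\<lambda>i. map (\<lambda>j. of_bool ((i, j) \<in> prec I)) [0..<n]) [0..<n])))"
    by (simp only: input_size_append input_size_blocks)
  moreover have "input_size [a, b, c, d] = cost a + cost b + cost c + cost d" for a b c d
    by (simp add: input_size_def)
  ultimately show ?thesis by simp
qed

text \<open>Stated for all prefixes because \<open>Read_input\<close> stores the partial
  products.\<close>

lemma PD_bound: "(\<Prod>j<k. pd j) \<le> 2 ^ input_size xs" and WD_bound: "(\<Prod>j<k. wd j) \<le> 2 ^ input_size xs"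
  if "k \<le> n"
proof -
  have "(\<Sum>j<k. cost (pd j)) \<le> (\<Sum>j<n. cost (pd j))" "(\<Sum>j<k. cost (wd j)) \<le> (\<Sum>j<n. cost (wd j))"
    using that by (auto intro!: sum_mono2)
  moreover have "(\<Sum>j<n. cost (pd j)) \<le> input_size xs" "(\<Sum>j<n. cost (wd j)) \<le> input_size xs"
    using size_blocks by (simp_all add: sum.distrib)
  ultimately have "(\<Sum>j<k. cost (pd j)) \<le> input_size xs" "(\<Sum>j<k. cost (wd j)) \<le> input_size xs"
    by linarith+
  then show "(\<Prod>j<k. pd j) \<le> 2 ^ input_size xs" "(\<Prod>j<k. wd j) \<le> 2 ^ input_size xs"
    using prod_less_power_cost[of pd k] prod_less_power_cost[of wd k] by (meson le_trans one_le_numeral power_increasing)+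
qed

lemma power_kappa: "(2::nat) ^ \<kappa> = 4 * (2 ^ input_size xs * 2 ^ input_size xs * 2 ^ input_size xs)"
  by (simp add: \<kappa>_def power_add mult_2 numeral_3_eq_3)

lemma small_less_kappa:
  fixes x :: nat
  shows "x \<le> 2 ^ input_size xs \<Longrightarrow> x < 2 ^ \<kappa>"
proof -
  assume "x \<le> 2 ^ input_size xs"
  also have "(2::nat) ^ input_size xs < 2 ^ \<kappa>" by (intro power_strict_increasing) (simp_all add: \<kappa>_def)
  finally show ?thesis .
qed

lemma mem_xs: "j < n \<Longrightarrow> pn j \<in> set xs" "j < n \<Longrightarrow> wn j \<in> set xs" "n \<in> set xs"
  unfolding xs_eq by auto

lemma sum_bounds: "sum p {..<n} < 2 ^ \<kappa>" "sum w {..<n} < 2 ^ \<kappa>"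
proof -
  let ?B = "2 ^ input_size xs :: nat"
  have "p j \<le> ?B * ?B" if "j < n" for j
    unfolding p_def using entry_bound[OF mem_xs(1)[OF that]] PD_bound[of n]
    by (intro mult_le_mono) (auto simp: PD_def intro: le_trans[OF div_le_dividend])
  then have "sum p {..<n} \<le> n * (?B * ?B)" using sum_bounded_above[of "{..<n}" p "?B * ?B"] by simp
  moreover have "w j \<le> ?B * ?B" if "j < n" for j
    unfolding w_def using entry_bound[OF mem_xs(2)[OF that]] WD_bound[of n]
    by (intro mult_le_mono) (auto simp: WD_def intro: le_trans[OF div_le_dividend])
  then have "sum w {..<n} \<le> n * (?B * ?B)" using sum_bounded_above[of "{..<n}" w "?B * ?B"] by simp
  moreover have "n * (?B * ?B) < 2 ^ \<kappa>"
  proof -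
    have "n * (?B * ?B) \<le> ?B * (?B * ?B)" using entry_bound[OF mem_xs(3)] by (intro mult_le_mono1) simp
    also have "\<dots> < 2 ^ \<kappa>" unfolding power_kappa by simp
    finally show ?thesis .
  qed
  ultimately show "sum p {..<n} < 2 ^ \<kappa>" "sum w {..<n} < 2 ^ \<kappa>" by linarith+
qed

sublocale or_program \<kappa> "input_size xs" n "prec I" p w
proof unfold_locales
  show "multitree {..<n} (prec I)" using multi by (simp add: jobs_def n_def)
  have "2 * n + 1 \<le> 2 * 2 ^ input_size xs"
    using entry_bound[OF mem_xs(3)] by simp
  also have "\<dots> < 2 ^ \<kappa>"
    using power_strict_increasing[of "Suc (input_size xs)" \<kappa> "2::nat"] by (simp add: \<kappa>_def)
  finally show "2 * n + 1 < 2 ^ \<kappa>" .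
qed (use n_le sum_bounds in \<open>simp_all add: \<kappa>_def\<close>)

lemma bounded_input: "bounded input"
  unfolding bounded_def
proof (intro allI)
  fix x i
  have "length xs \<le> 2 ^ input_size xs"
    using length_le_input_size[of xs] less_exp[of "input_size xs"] by linarith
  moreover have "xs ! k \<le> 2 ^ input_size xs" if "k < length xs" for k
    using entry_bound[OF nth_mem[OF that]] by simp
  ultimately have "input x i \<le> 2 ^ input_size xs"
    by (cases i) (auto simp: input_memory_def)
  then show "input x i < 2 ^ \<kappa>" by (rule small_less_kappa)
qed

lemma wp_Read_input:
  "wp Read_input (\<lambda>s'. s' ''n'' 0 = n \<and> s' ''P'' 0 = PD \<and> s' ''W'' 0 = WD) input"
  unfolding Read_input_def
proof (rule wp_bounded, intro wp_Seq_Assign, goal_cases)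
  case 4
  have n: "input ''in'' (Suc 0) = n" using input_Suc[of 0] length_xs by (simp add: xs_eq)
  show ?case
  proof (rule wp_For[where n = n and I = "\<lambda>k s'. s' ''P'' 0 = (\<Prod>j<k. pd j) \<and> s' ''W'' 0 = (\<Prod>j<k. wd j)"], goal_cases)
    case (8 k s')
    then have "s' ''in'' (3 + 4 * k) = pd k" "s' ''in'' (5 + 4 * k) = wd k" using input_jobs[of k] by simp_all
    moreover have "(\<Prod>j<Suc k. pd j) < 2 ^ \<kappa>" "(\<Prod>j<Suc k. wd j) < 2 ^ \<kappa>"
      using 8(1) PD_bound[of "Suc k"] WD_bound[of "Suc k"] small_less_kappa by simp_all
    ultimately show ?case using 8(2,5) by (intro wp_Seq_Assign wp_Assign) simp_all
  next
    case (9 s')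
    have "s' ''n'' 0 = n" using 9(1) n by simp
    then show ?case using 9(2) by (simp add: PD_def WD_def)
  qed (use n n_le in simp_all)
qed simp_all

lemma wp_Scale:
  assumes "s ''n'' 0 = n" "s ''P'' 0 = PD" "s ''W'' 0 = WD" "s ''in'' = input ''in''"
  shows "wp Scale (\<lambda>s'. agrees (s' ''p'') p \<and> agrees (s' ''w'') w) s"
  unfolding Scale_def
proof (rule wp_For[where n = n and I = "\<lambda>k s'. (\<forall>i<k. s' ''p'' i = p i) \<and> (\<forall>i<k. s' ''w'' i = w i)"], goal_cases)
  case (8 k s')
  then have "s' ''in'' = input ''in''" "s' ''P'' 0 = PD" "s' ''W'' 0 = WD" using assms by simp_all
  then have "s' ''in'' (2 + 4 * k) = pn k" "s' ''in'' (3 + 4 * k) = pd k"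
    "s' ''in'' (4 + 4 * k) = wn k" "s' ''in'' (5 + 4 * k) = wd k" "s' ''P'' 0 = PD" "s' ''W'' 0 = WD"
    using input_jobs[OF 8(1)] by (simp_all only:)
  moreover have "p k < 2 ^ \<kappa>" "w k < 2 ^ \<kappa>"
    using sum_bounds member_le_sum[of k "{..<n}" p] member_le_sum[of k "{..<n}" w] 8(1) by auto
  ultimately show ?case using 8(2,5)
    by (intro wp_Seq_Assign wp_Assign) (simp_all add: less_Suc_eq p_def w_def)
next
  case (9 s')
  then show ?case by (simp add: agrees_def)
qed (use assms n_le in simp_all)

lemma wp_Or_schedule:
  "wp Or_schedule (\<lambda>s'. s' ''out'' 0 = 2 * n \<and> (\<exists>B t S. output_agrees (s' ''out'') {} PD S \<and> greedy_state {} B t S)) input"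
  unfolding Or_schedule_def
proof (rule wp_Seq[OF wp_Read_input], goal_cases)
  case (1 s1)
  \<comment> \<open>The program does not initialise the block and the clock: cells outside the input
    array are 0, which represents the empty block at time 0.\<close>
  then have s1: "s1 ''n'' 0 = n" "s1 ''P'' 0 = PD" "s1 ''W'' 0 = WD" "s1 ''in'' = input ''in''"
    "s1 ''B'' = (\<lambda>_. 0)" "s1 ''t'' = (\<lambda>_. 0)"
    by (simp_all add: input_memory_def)
  show ?case
  proof (rule wp_Seq[OF wp_Scale[OF s1(1-4)]], goal_cases)
    case (1 s2)
    then have s2: "s2 ''n'' 0 = n" "s2 ''P'' 0 = PD" "s2 ''in'' = input ''in''"
      "s2 ''B'' = (\<lambda>_. 0)" "s2 ''t'' = (\<lambda>_. 0)" "agrees (s2 ''p'') p" "agrees (s2 ''w'') w"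
      using s1 by simp_all
    have adj: "adjacency_matrix (input ''in'')" using input_matrix by (simp add: adjacency_matrix_def)
    then have "adjacency_matrix (s2 ''in'')" using s2(3) by simp
    note init = wp_Init_jobs[OF s2(1) this]
    show ?case
    proof (rule wp_Seq[OF init], goal_cases)
      case (1 s3)
      then have s3: "s3 ''n'' 0 = n" "s3 ''P'' 0 = PD" "adjacency_matrix (s3 ''in'')"
        "s3 ''B'' = (\<lambda>_. 0)" "s3 ''t'' = (\<lambda>_. 0)" "agrees (s3 ''p'') p" "agrees (s3 ''w'') w"
        "indicates (s3 ''R'') {..<n}" "agrees (s3 ''a'') (\<lambda>i. of_bool (available {..<n} i))"
        using s2 adj by simp_all
      show ?case
      proof (rule wp_Seq[OF wp_Init_reach[OF s3(1,3)]], goal_cases)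
        case (1 s4)
        then have s4: "s4 ''n'' 0 = n" "s4 ''P'' 0 = PD" "adjacency_matrix (s4 ''in'')"
          "s4 ''B'' = (\<lambda>_. 0)" "s4 ''t'' = (\<lambda>_. 0)" "agrees (s4 ''p'') p" "agrees (s4 ''w'') w"
          "indicates (s4 ''R'') {..<n}" "agrees (s4 ''a'') (\<lambda>i. of_bool (available {..<n} i))"
          using s3 by simp_all
        show ?case
        proof (rule wp_Seq[OF wp_Warshall[OF s4(1) 1(3)]], goal_cases)
          case (1 s5)
          then have "represents s5 PD {..<n} {} (\<lambda>_. 0)"
            using s4 greedy_state_start
            by (simp add: represents_def indicates_def output_agrees_def)
          note greedy = wp_Greedy[OF this]
          have n5: "s5 ''n'' 0 = n" using 1(1) s4(1) by simp
          show ?case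
          proof (rule wp_Seq[OF greedy], goal_cases)
            case (1 s6)
            then obtain B t S where "output_agrees (s6 ''out'') {} PD S" "greedy_state {} B t S" by blast
            moreover have "s6 ''n'' 0 = n" using 1(1) n5 by simp
            moreover from calculation have "output_agrees ((s6 ''out'')(0 := 2 * n)) {} PD S"
              by (simp add: output_agrees_def)
            ultimately show ?case using n_bound by (intro wp_Assign) auto
          qed
        qed
      qed
    qed
  qed
qed

text \<open>Multiplying start times by \<open>PD\<close> maps schedules of the instance to those of
  the integral instance and changes all objectives by the same factor \<open>PD * WD\<close>, so the
  ratio 4 carries over.\<close>

lemma Or_schedule_correct:
  "\<exists>t s S. exec Or_schedule input t s \<and> t \<le> ctime (input_size xs) Or_schedule * (1 + \<kappa>) \<and>
     encodes_schedule (njobs I) (output_list s) S \<and>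
     feasible (jobs I) (ptime_real I) (prec I) S \<and>
     objective (jobs I) (ptime_real I) (weight_real I) S
       \<le> 4 * optimum (jobs I) (ptime_real I) (weight_real I) (prec I)"
proof -
  obtain t s B \<tau> S where run: "exec Or_schedule input t s" "t \<le> ctime (input_size xs) Or_schedule * (1 + \<kappa>)"
    and out: "s ''out'' 0 = 2 * n" "output_agrees (s ''out'') {} PD S" and state: "greedy_state {} B \<tau> S"
    using wp_Or_schedule bounded_input unfolding wp_def by blast
  define S' where "S' j = real (S j) / real PD" for j
  have PD: "0 < real PD" and WD: "0 < real WD" using denominators by simp_all
  have jobs: "jobs I = {..<n}" by (simp add: jobs_def n_def)
  have feas: "feasible (jobs I) (ptime_real I) (prec I) X \<longleftrightarrow>
      feasible {..<n} pr (prec I) (\<lambda>j. X j * real PD)" for X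
  proof -
    have "feasible (jobs I) (ptime_real I) (prec I) X \<longleftrightarrow>
      feasible {..<n} (\<lambda>j. pr j / real PD) (prec I) (\<lambda>j. X j * real PD / real PD)"
    proof -
      \<comment> \<open>The rational and the scaled data agree only on jobs below \<open>n\<close>;
        by \<open>E_sub\<close> all predecessors are among these.\<close>
      have "completion (ptime_real I) X j = completion (\<lambda>j. pr j / real PD) (\<lambda>j. X j * real PD / real PD) j" if "j < n" for j
        using that PD by (simp add: completion_def ptime_real_eq)
      moreover have "i < n" if "(i, j) \<in> prec I" for i j using E_sub that by auto
      ultimately show ?thesis unfolding feasible_def jobs using PD
        by (intro conj_cong ball_cong refl imp_cong ex_cong1) auto
    qed
    then show ?thesis unfolding feasible_scale[OF PD] .
  qed
  have obj: "objective (jobs I) (ptime_real I) (weight_real I) X =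
      objective {..<n} pr wr (\<lambda>j. X j * real PD) / (real PD * real WD)" for X
  proof -
    have "objective (jobs I) (ptime_real I) (weight_real I) X =
      objective {..<n} (\<lambda>j. pr j / real PD) (\<lambda>j. wr j / real WD) (\<lambda>j. X j * real PD / real PD)"
      unfolding objective_def jobs completion_def using PD
      by (intro sum.cong) (simp_all add: ptime_real_eq weight_real_eq)
    then show ?thesis unfolding objective_scale .
  qed
  have S: "(\<lambda>j. S' j * real PD) = (\<lambda>j. real (S j))" using PD by (simp add: S'_def)
  have feas_S: "feasible (jobs I) (ptime_real I) (prec I) S'"
    unfolding feas S by (rule greedy_state_finish(1)[OF state])
  \<comment> \<open>The optimum is an infimum, so the factor is moved to the left to obtain a lower
    bound on all feasible objectives; the computed schedule shows that there are any.\<close>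
  moreover have "objective (jobs I) (ptime_real I) (weight_real I) S' / 4
      \<le> optimum (jobs I) (ptime_real I) (weight_real I) (prec I)"
    unfolding optimum_def
  proof (rule cINF_greatest)
    show "{S. feasible (jobs I) (ptime_real I) (prec I) S} \<noteq> {}" using feas_S by blast
  next
    fix X assume "X \<in> {S. feasible (jobs I) (ptime_real I) (prec I) S}"
    then have "objective {..<n} pr wr (\<lambda>j. real (S j)) \<le> 4 * objective {..<n} pr wr (\<lambda>j. X j * real PD)"
      unfolding mem_Collect_eq feas by (rule greedy_state_finish(2)[OF state])
    then show "objective (jobs I) (ptime_real I) (weight_real I) S' / 4
      \<le> objective (jobs I) (ptime_real I) (weight_real I) X"
      unfolding obj S using PD WD by (simp add: field_simps)
  qed
  moreover have "encodes_schedule (njobs I) (output_list s) S'"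
  proof -
    have "output_list s ! i = s ''out'' (Suc i)" if "i < 2 * n" for i
      using that out(1) by (simp add: output_list_def nth_append del: upt_Suc)
    then show ?thesis
      using out denominators unfolding encodes_schedule_def n_def[symmetric]
      by (simp add: output_list_def output_agrees_def S'_def del: upt_Suc)
  qed
  ultimately show ?thesis using run by (intro exI[of _ t] exI[of _ s] exI[of _ S']) simp
qed

end

theorem theorem4:
  "\<exists>algorithm :: com.
     polytime_approximation 4 {I. valid_inst I \<and> multitree (jobs I) (prec I)} algorithm"
proof -
  obtain q where q: "\<And>N. ctime N Or_schedule = poly q N" using ctime_poly by blast
  have "polytime_approximation 4 {I. valid_inst I \<and> multitree (jobs I) (prec I)} Or_schedule"
    unfolding polytime_approximation_def
  \<comment> \<open>The factor \<open>[:3, 3:]\<close> is \<open>1 + \<kappa>\<close> as a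
    polynomial in the input size.\<close>
  proof (intro exI[of _ "q * [:3, 3:]"] ballI)
    fix I assume "I \<in> {I. valid_inst I \<and> multitree (jobs I) (prec I)}"
    then interpret encoded_inst I by unfold_locales auto
    show "\<exists>t s S. exec Or_schedule (input_memory (encode_inst I)) t s \<and>
        t \<le> poly (q * [:3, 3:]) (input_size (encode_inst I)) \<and>
        encodes_schedule (njobs I) (output_list s) S \<and>
        feasible (jobs I) (ptime_real I) (prec I) S \<and>
        objective (jobs I) (ptime_real I) (weight_real I) S
          \<le> 4 * optimum (jobs I) (ptime_real I) (weight_real I) (prec I)"
      using Or_schedule_correct unfolding q xs_def \<kappa>_def by (simp add: algebra_simps)
  qed
  then show ?thesis ..
qed

end
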